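(* Let $\Gamma$ be a countable group and $\Lambda$ a normal subgroup with $\Gamma/\Lambda$ amenable. Let $\Gamma\curvearrowright(X,\mu)$ be a p.m.p. action that weakly contains some p.m.p. action $\Gamma\curvearrowright(Y,\nu)$ in which every point of $Y$ has stabilizer exactly $\Lambda$. If the restricted action $\Lambda\curvearrowright(X,\mu)$ is existentially closed (as an action of $\Lambda$), then $\Gamma\curvearrowright(X,\mu)$ is existentially closed.
   Context: p.m.p. = probability measure-preserving. Weak containment: $\Gamma\curvearrowright(X,\mu)$ weakly contains $\Gamma\curvearrowright(Y,\nu)$ if for all measurable $A_1,\dots,A_n\subseteq Y$, finite $F\subseteq\Gamma$, $\epsilon>0$ there are measurable $B_i\subseteq X$ with $|\nu(\gamma A_i\cap A_j)-\mu(\gamma B_i\cap B_j)|<\epsilon$ for all $i,j$, $\gamma\in F$. For a group $G$ acting, $\alpha:Z\to p=\{0,\dots,p-1\}$, finite $S\subseteq G$: $\alpha_S(z)(s)=\alpha(s^{-1}z)$. A factor map $\phi:(Z,\eta)\to(X,\mu)$ of p.m.p. $G$-actions is existentially closed if for all $p,q$, measurable $\alpha:Z\to p$, $\beta:X\to q$, finite $S\subseteq G$, $\epsilon>0$ there is measurable $\tilde\alpha:X\to p$ with $|\eta(\alpha_S^{-1}(\pi)\cap\phi^{-1}\beta^{-1}(j))-\mu(\tilde\alpha_S^{-1}(\pi)\cap\beta^{-1}(j))|<\epsilon$ for all $\pi,j$; a $G$-action is existentially closed if every factor map onto it from a p.m.p. $G$-action is. *)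

theory Defs
  imports "HOL-Probability.Probability" "HOL-Algebra.Coset" "HOL-Algebra.Group_Action"
begin

section \<open>Amenable groups\<close>

text \<open>Amenability of a discrete group: there is a left-invariant finitely additive probability
  measure defined on all subsets of the group.\<close>

definition amenable :: "('g, 'm) monoid_scheme \<Rightarrow> bool" where
  "amenable G \<longleftrightarrow> group G \<and>
    (\<exists>m :: 'g set \<Rightarrow> real.
       (\<forall>A \<subseteq> carrier G. 0 \<le> m A) \<and>
       m (carrier G) = 1 \<and>
       (\<forall>A \<subseteq> carrier G. \<forall>B \<subseteq> carrier G. A \<inter> B = {} \<longrightarrow> m (A \<union> B) = m A + m B) \<and>
       (\<forall>g \<in> carrier G. \<forall>A \<subseteq> carrier G. m (g <#\<^bsub>G\<^esub> A) = m A))"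


section \<open>Probability measure-preserving actions\<close>

definition standard_borel :: "'x measure \<Rightarrow> bool" where
  "standard_borel M \<longleftrightarrow>
    (\<exists>T. topspace T = space M \<and> completely_metrizable_space T \<and> separable_space T \<and>
         sets M = sigma_sets (topspace T) {U. openin T U})"

definition pmp_action ::
    "('g, 'm) monoid_scheme \<Rightarrow> 'x measure \<Rightarrow> ('g \<Rightarrow> 'x \<Rightarrow> 'x) \<Rightarrow> bool" where
  "pmp_action G M a \<longleftrightarrow>
    standard_borel M \<and> prob_space M \<and> group_action G (space M) a \<and>
    (\<forall>g \<in> carrier G. a g \<in> measurable M M \<and> distr M M (a g) = M)"

definition weakly_contains ::
    "('g, 'm) monoid_scheme \<Rightarrow> 'x measure \<Rightarrow> ('g \<Rightarrow> 'x \<Rightarrow> 'x) \<Rightarrow> 'y measure \<Rightarrow> ('g \<Rightarrow> 'y \<Rightarrow> 'y) \<Rightarrow> bool"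
    where
  "weakly_contains G X a Y b \<longleftrightarrow>
    (\<forall>(n::nat) A F (\<epsilon>::real).
       (\<forall>i<n. A i \<in> sets Y) \<and> finite F \<and> F \<subseteq> carrier G \<and> 0 < \<epsilon> \<longrightarrow>
       (\<exists>B. (\<forall>i<n. B i \<in> sets X) \<and>
            (\<forall>i<n. \<forall>j<n. \<forall>g\<in>F.
               \<bar>measure Y (b g ` A i \<inter> A j) - measure X (a g ` B i \<inter> B j)\<bar> < \<epsilon>)))"


section \<open>Existentially closed actions\<close>

text \<open>A factor map is only required to be equivariant almost everywhere.\<close>

definition factor_map ::
    "('g, 'm) monoid_scheme \<Rightarrow> 'z measure \<Rightarrow> ('g \<Rightarrow> 'z \<Rightarrow> 'z) \<Rightarrow> 'x measure \<Rightarrow> ('g \<Rightarrow> 'x \<Rightarrow> 'x) \<Rightarrow>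
     ('z \<Rightarrow> 'x) \<Rightarrow> bool" where
  "factor_map G Z b X a f \<longleftrightarrow>
    pmp_action G Z b \<and> pmp_action G X a \<and>
    f \<in> measurable Z X \<and> distr Z X f = X \<and>
    (\<forall>g \<in> carrier G. AE z in Z. f (b g z) = a g (f z))"

text \<open>The function written \<open>\<alpha>\<close> with subscript \<open>S\<close> in the literature, with values in
  \<open>S \<rightarrow>\<^sub>E {..<p}\<close>.\<close>

definition translates ::
    "('g, 'm) monoid_scheme \<Rightarrow> ('g \<Rightarrow> 'z \<Rightarrow> 'z) \<Rightarrow> 'g set \<Rightarrow> ('z \<Rightarrow> nat) \<Rightarrow> 'z \<Rightarrow> 'g \<Rightarrow> nat" where
  "translates G b S \<alpha> z = (\<lambda>s\<in>S. \<alpha> (b (inv\<^bsub>G\<^esub> s) z))"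

definition ec_factor_map ::
    "('g, 'm) monoid_scheme \<Rightarrow> 'z measure \<Rightarrow> ('g \<Rightarrow> 'z \<Rightarrow> 'z) \<Rightarrow> 'x measure \<Rightarrow> ('g \<Rightarrow> 'x \<Rightarrow> 'x) \<Rightarrow>
     ('z \<Rightarrow> 'x) \<Rightarrow> bool" where
  "ec_factor_map G Z b X a f \<longleftrightarrow>
    factor_map G Z b X a f \<and>
    (\<forall>(p::nat) (q::nat). \<forall>\<alpha> \<in> measurable Z (count_space {..<p}).
     \<forall>\<beta> \<in> measurable X (count_space {..<q}). \<forall>S (\<epsilon>::real).
       finite S \<and> S \<subseteq> carrier G \<and> 0 < \<epsilon> \<longrightarrow>
       (\<exists>\<alpha>' \<in> measurable X (count_space {..<p}).
          \<forall>\<pi> \<in> S \<rightarrow>\<^sub>E {..<p}. \<forall>j<q.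
            \<bar>measure Z (translates G b S \<alpha> -` {\<pi>} \<inter> f -` (\<beta> -` {j}) \<inter> space Z)
             - measure X (translates G a S \<alpha>' -` {\<pi>} \<inter> \<beta> -` {j} \<inter> space X)\<bar> < \<epsilon>))"

text \<open>A definition cannot quantify over all types. Every standard Borel space has at most
  continuum many points, hence is isomorphic to one whose points are real numbers, so letting
  \<open>Z\<close> range over the standard probability spaces with carrier a set of reals (and
  an arbitrary Polish topology on that set) loses nothing; see \<open>ec_action_factor_map\<close> below.\<close>

definition ec_action ::
    "('g, 'm) monoid_scheme \<Rightarrow> 'x measure \<Rightarrow> ('g \<Rightarrow> 'x \<Rightarrow> 'x) \<Rightarrow> bool" where
  "ec_action G X a \<longleftrightarrow>
    pmp_action G X a \<and>
    (\<forall>(Z :: real measure) b f. factor_map G Z b X a f \<longrightarrow> ec_factor_map G Z b X a f)"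


lemma standard_borel_inj_real:
  assumes "standard_borel (M :: 'x measure)"
  obtains e :: "'x \<Rightarrow> real" where "inj_on e (space M)"
proof -
  obtain T where T: "topspace T = space M" "completely_metrizable_space T" "separable_space T"
    using assms by (auto simp: standard_borel_def)
  obtain S d where "Metric_space S d" and Td: "T = Metric_space.mtopology S d"
    using T(2) by (auto simp: completely_metrizable_space_def)
  interpret Metric_space S d by fact
  have S: "S = space M" using T(1) Td by simp
  obtain C where C: "countable C" "C \<subseteq> S" "mtopology closure_of C = S"
    using T(3) by (auto simp: separable_space_def Td)
  define c where "c = (\<lambda>x. {p. d x (from_nat_into C (fst (prod_decode p)))
    < inverse (real (Suc (snd (prod_decode p))))})"
  have "inj_on c S"
  proof (rule inj_onI, rule ccontr)
    fix x y assume xy: "x \<in> S" "y \<in> S" "c x = c y" "x \<noteq> y"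
    then have "0 < d x y / 2" by simp
    then obtain n where n: "inverse (real (Suc n)) < d x y / 2"
      using reals_Archimedean by blast
    have "x \<in> mtopology closure_of C" using xy C by simp
    then obtain z where z: "z \<in> C" "d x z < inverse (real (Suc n))"
      by (auto simp: metric_closure_of in_mball dest!: spec[of _ "inverse (real (Suc n))"])
    obtain k where k: "from_nat_into C k = z"
      using C(1) z(1) by (metis from_nat_into_to_nat_on)
    have "prod_encode (k, n) \<in> c x" using z k by (simp add: c_def)
    then have "prod_encode (k, n) \<in> c y" using xy by simp
    then have "d y z < inverse (real (Suc n))" using k by (simp add: c_def)
    moreover have "d x y \<le> d x z + d z y" using xy z C by (intro triangle) auto
    ultimately show False using z n commute[of y z] by linarith
  qed
  moreover obtain r :: "nat set \<Rightarrow> real" where "inj r"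
    using nat_sets_eqpoll_reals by (auto simp: eqpoll_def bij_betw_def)
  ultimately have "inj_on (r \<circ> c) (space M)"
    using S by (auto intro: comp_inj_on inj_on_subset)
  then show thesis by (rule that)
qed

lemma pmp_action_embed:
  assumes Z: "pmp_action G Z b" and inj: "inj_on e (space Z)"
  shows "pmp_action G (embed_measure Z e)
           (\<lambda>g. \<lambda>y \<in> e ` space Z. e (b g (the_inv_into (space Z) e y)))"
    (is "pmp_action G ?N ?c")
proof -
  define i where "i = the_inv_into (space Z) e"
  have ie: "i (e z) = z" if "z \<in> space Z" for z
    using inj that by (simp add: i_def the_inv_into_f_f)
  have N: "space ?N = e ` space Z" by (rule space_embed_measure)
  have setsN: "sets ?N = {e ` A |A. A \<in> sets Z}" by (rule sets_embed_measure'[OF inj])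
  have vim: "i -` A \<inter> e ` space Z = e ` A" if "A \<subseteq> space Z" for A
    unfolding i_def using inj that by (rule the_inv_into_vimage)
  interpret prob_space Z using Z by (simp add: pmp_action_def)
  interpret group_action G "space Z" b using Z by (simp add: pmp_action_def)
  interpret H: group_hom G "BijGroup (space Z)" b by (rule group_hom)
  have e_meas: "e \<in> measurable Z ?N" by (rule measurable_embed_measure2'[OF inj])
  have eN: "?N = distr Z ?N e" by (rule embed_measure_eq_distr'[OF inj])
  have i_meas: "i \<in> measurable ?N Z"
    by (rule measurable_embed_measure1) (simp add: ie cong: measurable_cong)
  have bb: "b g \<in> extensional (space Z)" "bij_betw (b g) (space Z) (space Z)"
    if "g \<in> carrier G" for g
    using H.hom_closed[OF that] by (auto simp: BijGroup_def Bij_def)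
  have bs: "b g z \<in> space Z" if "g \<in> carrier G" "z \<in> space Z" for g z
    using bb(2)[OF that(1)] that(2) by (auto simp: bij_betw_def)

  have sb: "standard_borel ?N"
  proof -
    obtain T where T: "topspace T = space Z" "completely_metrizable_space T" "separable_space T"
      "sets Z = sigma_sets (topspace T) {U. openin T U}"
      using Z by (auto simp: pmp_action_def standard_borel_def)
    define T' where "T' = pullback_topology (e ` space Z) i T"
    have top: "topspace T' = e ` space Z"
      using vim[of "space Z"] by (simp add: T'_def topspace_pullback_topology T(1))
    have "homeomorphic_maps T T' e i"
      unfolding homeomorphic_maps_def
    proof (intro conjI)
      show "continuous_map T T' e"
        unfolding T'_def
      proof (rule continuous_map_pullback')
        show "continuous_map T T (i \<circ> e)"
          by (rule continuous_map_eq[OF continuous_map_id]) (simp add: T(1) ie)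
      qed (auto simp: T(1))
      show "continuous_map T' T i"
        using continuous_map_pullback[OF continuous_map_id, of "e ` space Z" i T]
        by (simp add: T'_def)
    qed (auto simp: top T(1) ie)
    then have "T homeomorphic_space T'" by (auto simp: homeomorphic_space_def)
    then have "completely_metrizable_space T'" "separable_space T'"
      using T homeomorphic_completely_metrizable_space homeomorphic_separable_space by blast+
    moreover have "sets ?N = sigma_sets (topspace T') {U. openin T' U}"
    proof -
      have "sets ?N = {i -` A \<inter> e ` space Z |A. A \<in> sets Z}"
        unfolding setsN Setcompr_eq_image
        by (rule image_cong[OF refl]) (rule vim[OF sets.sets_into_space, symmetric])
      also have "\<dots> = sigma_sets (e ` space Z) {i -` A \<inter> e ` space Z |A. A \<in> {U. openin T U}}"
        unfolding T(4) by (rule sigma_sets_vimage_commute) (auto simp: T(1) ie)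
      also have "{i -` A \<inter> e ` space Z |A. A \<in> {U. openin T U}} = {U. openin T' U}"
        by (auto simp: T'_def openin_pullback_topology)
      finally show ?thesis by (simp add: top)
    qed
    ultimately show ?thesis
      unfolding standard_borel_def using top N by blast
  qed

  have ps: "prob_space ?N"
    by (subst eN) (rule prob_space_distr[OF e_meas])

  have ci: "?c g = (\<lambda>y \<in> e ` space Z. e (b g (i y)))" for g by (simp add: i_def)
  have Bij: "?c g \<in> Bij (e ` space Z)" if g: "g \<in> carrier G" for g
  proof -
    have "bij_betw (\<lambda>y. e (b g (i y))) (e ` space Z) (e ` space Z)"
    proof -
      have "bij_betw i (e ` space Z) (space Z)"
        unfolding i_def using inj by (simp add: bij_betw_the_inv_into inj_on_imp_bij_betw)
      moreover have "bij_betw e (space Z) (e ` space Z)"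
        using inj by (simp add: inj_on_imp_bij_betw)
      ultimately have "bij_betw (e \<circ> (b g \<circ> i)) (e ` space Z) (e ` space Z)"
        using bb(2)[OF g] by (blast intro: bij_betw_trans)
      then show ?thesis by (simp add: o_def)
    qed
    then have "bij_betw (?c g) (e ` space Z) (e ` space Z)"
      unfolding ci by (subst bij_betw_cong[where g = "\<lambda>y. e (b g (i y))"]) auto
    then show ?thesis by (simp add: Bij_def)
  qed
  have ga: "group_action G (space ?N) ?c"
    unfolding group_action_def N group_hom_def group_hom_axioms_def
  proof (intro conjI homI)
    show "Group.group G" by (rule H.G.is_group)
    show "Group.group (BijGroup (e ` space Z))" by (rule group_BijGroup)
    show "?c g \<in> carrier (BijGroup (e ` space Z))" if "g \<in> carrier G" for g
      using Bij[OF that] by (simp add: BijGroup_def)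
    fix g h assume gh: "g \<in> carrier G" "h \<in> carrier G"
    show "?c (g \<otimes>\<^bsub>G\<^esub> h) = ?c g \<otimes>\<^bsub>BijGroup (e ` space Z)\<^esub> ?c h"
    proof -
      have "?c (g \<otimes>\<^bsub>G\<^esub> h) = compose (e ` space Z) (?c g) (?c h)"
        unfolding ci compose_def
        using gh by (auto simp: ie bs composition_rule simp del: H.hom_mult intro!: restrict_ext)
      also have "\<dots> = ?c g \<otimes>\<^bsub>BijGroup (e ` space Z)\<^esub> ?c h"
        unfolding BijGroup_def using Bij[OF gh(1)] Bij[OF gh(2)] by simp
      finally show ?thesis .
    qed
  qed

  have mp: "?c g \<in> measurable ?N ?N \<and> distr ?N ?N (?c g) = ?N" if g: "g \<in> carrier G" for g
  proof
    have bm: "b g \<in> measurable Z Z" and bd: "distr Z Z (b g) = Z"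
      using Z g by (auto simp: pmp_action_def)
    have "(\<lambda>y. e (b g (i y))) \<in> measurable ?N ?N"
      using i_meas bm e_meas by measurable
    then show cm: "?c g \<in> measurable ?N ?N"
      by (rule measurable_cong[THEN iffD1, rotated]) (simp add: N ci)
    have "distr ?N ?N (?c g) = distr (distr Z ?N e) ?N (?c g)"
      by (rule arg_cong[OF eN, of "\<lambda>M. distr M ?N (?c g)"])
    also have "\<dots> = distr Z ?N (?c g \<circ> e)" by (rule distr_distr[OF cm e_meas])
    also have "\<dots> = distr Z ?N (e \<circ> b g)"
      by (rule distr_cong) (auto simp: ci ie)
    also have "\<dots> = distr (distr Z Z (b g)) ?N e"
      by (rule distr_distr[OF e_meas bm, symmetric])
    also have "\<dots> = ?N" unfolding bd by (rule eN[symmetric])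
    finally show "distr ?N ?N (?c g) = ?N" .
  qed
  show ?thesis
    unfolding pmp_action_def using sb ps ga mp by blast
qed

theorem ec_action_factor_map:
  fixes Z :: "'z measure"
  assumes ec: "ec_action G X a" and f: "factor_map G Z b X a f"
  shows "ec_factor_map G Z b X a f"
proof -
  have Z: "pmp_action G Z b" and X: "pmp_action G X a" and fm: "f \<in> measurable Z X"
    and fd: "distr Z X f = X" and eq: "\<And>g. g \<in> carrier G \<Longrightarrow> AE z in Z. f (b g z) = a g (f z)"
    using f by (auto simp: factor_map_def)
  obtain e :: "'z \<Rightarrow> real" where inj: "inj_on e (space Z)"
    using Z standard_borel_inj_real by (auto simp: pmp_action_def)
  define i where "i = the_inv_into (space Z) e"
  define N where "N = embed_measure Z e"
  define c where "c = (\<lambda>g. \<lambda>y \<in> e ` space Z. e (b g (i y)))"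
  have ie: "i (e z) = z" if "z \<in> space Z" for z
    using inj that by (simp add: i_def the_inv_into_f_f)
  have N: "space N = e ` space Z" by (simp add: N_def space_embed_measure)
  have e_meas: "e \<in> measurable Z N"
    unfolding N_def by (rule measurable_embed_measure2'[OF inj])
  have eN: "N = distr Z N e"
    unfolding N_def by (rule embed_measure_eq_distr'[OF inj])
  have i_meas: "i \<in> measurable N Z"
    unfolding N_def by (rule measurable_embed_measure1) (simp add: ie cong: measurable_cong)
  interpret group_action G "space Z" b using Z by (simp add: pmp_action_def)
  have G: "Group.group G" using group_hom by (simp add: group_hom_def)
  have bs: "b g z \<in> space Z" if "g \<in> carrier G" "z \<in> space Z" for g z
    using element_image[OF that refl] .
  have "pmp_action G N c"
    unfolding N_def c_def i_def by (rule pmp_action_embed[OF Z inj])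
  moreover have "(f \<circ> i) \<in> measurable N X" using i_meas fm by (rule measurable_comp)
  moreover have "distr N X (f \<circ> i) = X"
  proof -
    have "distr N X (f \<circ> i) = distr (distr Z N e) X (f \<circ> i)"
      by (rule arg_cong[OF eN, of "\<lambda>M. distr M X (f \<circ> i)"])
    also have "\<dots> = distr Z X (f \<circ> i \<circ> e)"
      by (rule distr_distr) (use i_meas fm e_meas in \<open>auto intro: measurable_comp\<close>)
    also have "\<dots> = distr Z X f" by (rule distr_cong) (auto simp: ie)
    finally show ?thesis using fd by simp
  qed
  moreover have "AE y in N. (f \<circ> i) (c g y) = a g ((f \<circ> i) y)" if g: "g \<in> carrier G" for g
  proof -
    obtain K where K: "K \<in> null_sets Z" "{z \<in> space Z. f (b g z) \<noteq> a g (f z)} \<subseteq> K"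
      using eq[OF g] by (auto simp: eventually_ae_filter)
    have "i -` K \<inter> space N \<in> null_sets N"
    proof -
      have s: "i -` K \<inter> space N \<in> sets N" using i_meas K by (auto intro: measurable_sets)
      have "emeasure N (i -` K \<inter> space N) = emeasure (distr Z N e) (i -` K \<inter> space N)"
        by (rule arg_cong[OF eN, of "\<lambda>M. emeasure M (i -` K \<inter> space N)"])
      also have "\<dots> = emeasure Z (e -` (i -` K \<inter> space N) \<inter> space Z)"
        by (rule emeasure_distr[OF e_meas s])
      also have "e -` (i -` K \<inter> space N) \<inter> space Z = K"
      proof -
        have "K \<subseteq> space Z" using K(1) sets.sets_into_space[of K Z] by (simp add: null_sets_def)
        moreover have "z \<in> e -` (i -` K \<inter> space N) \<inter> space Z \<longleftrightarrow> z \<in> K \<and> z \<in> space Z" for z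
          by (cases "z \<in> space Z") (simp_all add: N ie)
        ultimately show ?thesis by blast
      qed
      finally show ?thesis using K s by (auto simp: null_sets_def)
    qed
    moreover have "{y \<in> space N. (f \<circ> i) (c g y) \<noteq> a g ((f \<circ> i) y)} \<subseteq> i -` K \<inter> space N"
      using K(2) g by (auto simp: N c_def ie bs)
    ultimately show ?thesis by (rule AE_I')
  qed
  ultimately have "factor_map G N c X a (f \<circ> i)"
    using X by (simp add: factor_map_def)
  then have ecN: "ec_factor_map G N c X a (f \<circ> i)"
    using ec by (simp add: ec_action_def)
  show ?thesis
    unfolding ec_factor_map_def
  proof (intro conjI f allI ballI impI)
    fix p q :: nat and \<alpha> \<beta> S and \<epsilon> :: real
    assume \<alpha>: "\<alpha> \<in> measurable Z (count_space {..<p})"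
      and \<beta>: "\<beta> \<in> measurable X (count_space {..<q})"
      and S: "finite S \<and> S \<subseteq> carrier G \<and> 0 < \<epsilon>"
    have \<alpha>i: "\<alpha> \<circ> i \<in> measurable N (count_space {..<p})"
      using i_meas \<alpha> by (rule measurable_comp)
    obtain \<alpha>' where \<alpha>': "\<alpha>' \<in> measurable X (count_space {..<p})"
      and main: "\<And>\<pi> j. \<pi> \<in> S \<rightarrow>\<^sub>E {..<p} \<Longrightarrow> j < q \<Longrightarrow>
            \<bar>measure N (translates G c S (\<alpha> \<circ> i) -` {\<pi>} \<inter> (f \<circ> i) -` (\<beta> -` {j}) \<inter> space N)
             - measure X (translates G a S \<alpha>' -` {\<pi>} \<inter> \<beta> -` {j} \<inter> space X)\<bar> < \<epsilon>"
      using ecN[unfolded ec_factor_map_def, THEN conjunct2, rule_format, OF \<alpha>i \<beta> S] by blast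
    have "measure N (translates G c S (\<alpha> \<circ> i) -` {\<pi>} \<inter> (f \<circ> i) -` (\<beta> -` {j}) \<inter> space N)
        = measure Z (translates G b S \<alpha> -` {\<pi>} \<inter> f -` (\<beta> -` {j}) \<inter> space Z)" for \<pi> j
    proof -
      let ?A = "translates G b S \<alpha> -` {\<pi>} \<inter> f -` (\<beta> -` {j}) \<inter> space Z"
      have tr: "translates G c S (\<alpha> \<circ> i) (e z) = translates G b S \<alpha> z" if "z \<in> space Z" for z
      proof -
        have "(\<alpha> \<circ> i) (c (inv\<^bsub>G\<^esub> s) (e z)) = \<alpha> (b (inv\<^bsub>G\<^esub> s) z)" if "s \<in> S" for s
        proof -
          have "inv\<^bsub>G\<^esub> s \<in> carrier G" using S \<open>s \<in> S\<close> group.inv_closed[OF G] by blast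
          then show ?thesis using \<open>z \<in> space Z\<close> by (simp add: c_def ie bs)
        qed
        then show ?thesis unfolding translates_def by (intro restrict_ext) simp
      qed
      have "translates G c S (\<alpha> \<circ> i) -` {\<pi>} \<inter> (f \<circ> i) -` (\<beta> -` {j}) \<inter> space N = e ` ?A"
        by (auto simp: N tr ie)
      moreover have "emeasure N (e ` ?A) = emeasure Z ?A"
      proof (cases "?A \<in> sets Z")
        case True
        then show ?thesis unfolding N_def by (rule emeasure_embed_measure_image'[OF inj])
      next
        case False
        have "e ` ?A \<notin> sets N"
        proof
          assume "e ` ?A \<in> sets N"
          then obtain B where "B \<in> sets Z" "e ` ?A = e ` B"
            unfolding N_def sets_embed_measure'[OF inj] by blast
          moreover from this have "?A = B"
            using inj_on_image_eq_iff[OF inj, of ?A B] sets.sets_into_space[of B Z] by auto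
          ultimately show False using False by simp
        qed
        then show ?thesis using False by (simp add: emeasure_notin_sets)
      qed
      ultimately show ?thesis by (simp add: measure_def)
    qed
    then show "\<exists>\<alpha>' \<in> measurable X (count_space {..<p}).
          \<forall>\<pi> \<in> S \<rightarrow>\<^sub>E {..<p}. \<forall>j<q.
            \<bar>measure Z (translates G b S \<alpha> -` {\<pi>} \<inter> f -` (\<beta> -` {j}) \<inter> space Z)
             - measure X (translates G a S \<alpha>' -` {\<pi>} \<inter> \<beta> -` {j} \<inter> space X)\<bar> < \<epsilon>"
      using \<alpha>' main by (intro bexI[of _ \<alpha>']) auto
  qed
qed

end

theory Submission
  imports Defs
begin

text \<open>Since \<open>\<Lambda>\<close> acts trivially on \<open>Y\<close> and \<open>Q = \<Gamma>/\<Lambda>\<close> acts freely, amenability of \<open>Q\<close> yields, for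
  every finite \<open>K \<subseteq> \<Gamma>\<close>, a measurable map \<open>c\<close> from \<open>Y\<close> to a finite subset of \<open>Q\<close> with
  \<open>c (k y) = (k \<Lambda>) c y\<close> for \<open>k \<in> K\<close> up to small measure: cut greedily truncated Foelner tiles out of
  the part of \<open>Y\<close> not yet covered. This property only involves the finite partition defined by
  \<open>c\<close>, so weak containment carries it over to \<open>X\<close>. On \<open>X\<close>, the map \<open>x \<mapsto> c(x)\<^sup>-\<^sup>1 x\<close> (with coset
  representatives) sends almost all of a tile to its base, up to \<open>\<Lambda>\<close>. Given an extension \<open>Z\<close>
  and \<open>\<alpha>\<close>, record \<open>w z = (\<alpha> (f z))\<close>, \<open>f\<close> ranging over the representatives, approximate \<open>w\<close> on \<open>X\<close> by
  \<open>w'\<close> using that the \<open>\<Lambda>\<close>-action is existentially closed, and put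
  \<open>\<alpha>' x = w' (c(x)\<^sup>-\<^sup>1 x) (c x)\<close>.\<close>

text \<open>The obstacle is that \<Lambda>-closedness controls only \<Lambda>-translates of a
  labelling of \<open>Z\<close>, while translates by a finite \<open>S\<close> in \<Gamma> must be
  matched. Labels read off the factor are not restricted in this way: any finite measurable
  partition of \<open>X\<close> is admissible as \<open>\<beta>\<close>, so the values of
  \<open>c\<close> and \<open>\<beta>\<close> at finitely many \<Gamma>-translates can be packed
  into one label. If \<open>c\<close> is equivariant at x along s^-1, the bases of x and s^-1 x
  differ by an element of \<Lambda>. Splitting by the value of \<open>c\<close> and moving each
  piece to its base preserves the measure. It turns the statistics of \<open>\<alpha>\<close> into a
  finite sum of events that \<Lambda>-closedness can copy, up to the small set where
  \<open>c\<close> is not equivariant.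

  For the tiling, cutting a tile down to the uncovered part could ruin its Foelner property. The cut
  costs nothing, however: a pair x, kx with exactly one point covered already counts as a defect.
  Only the Foelner boundary of a new tile is charged, and while the uncovered part is not small,
  some tile covers more than it costs. A bounded potential then stops the process.\<close>

section \<open>Foelner sets\<close>

text \<open>Rado's argument: delete elements of the \<open>A i\<close> as long as Hall's condition survives; by
  submodularity a maximal deletion leaves singletons.\<close>

lemma hall_marriage:
  fixes A :: "'i \<Rightarrow> 'x set"
  assumes fin: "\<And>i. i \<in> I \<Longrightarrow> finite (A i)"
    and hall: "\<And>J. finite J \<Longrightarrow> J \<subseteq> I \<Longrightarrow> card J \<le> card (\<Union>i\<in>J. A i)"
  obtains f where "inj_on f I" "\<And>i. i \<in> I \<Longrightarrow> f i \<in> A i"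
proof -
  define H where "H B \<longleftrightarrow> (\<forall>J. finite J \<longrightarrow> J \<subseteq> I \<longrightarrow> card J \<le> card (\<Union>i\<in>J. B i))" for B :: "'i \<Rightarrow> 'x set"
  define S where "S = {D. H (\<lambda>i. A i - D `` {i})}"
  have "{} \<in> S" using hall by (simp add: S_def H_def)
  moreover have "\<Union>C \<in> S" if C: "C \<noteq> {}" "subset.chain S C" for C
    unfolding S_def mem_Collect_eq H_def
  proof (intro allI impI)
    fix J assume J: "finite J" "J \<subseteq> I"
    \<comment> \<open>Hall's condition at \<open>J\<close> sees only deletions inside the finite set
      \<open>Sigma J A\<close>, and these all occur in a single member of the chain.\<close>
    have "finite (Sigma J A \<inter> \<Union>C)" using J fin by auto
    then obtain D where D: "D \<in> C" "Sigma J A \<inter> \<Union>C \<subseteq> D"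
      using finite_subset_Union_chain[of "Sigma J A \<inter> \<Union>C" C S] C by blast
    have "(\<Union>i\<in>J. A i - (\<Union>C) `` {i}) = (\<Union>i\<in>J. A i - D `` {i})"
      using D by blast
    moreover have "D \<in> S" using C(2) D(1) by (auto simp: subset.chain_def)
    ultimately show "card J \<le> card (\<Union>i\<in>J. A i - (\<Union>C) `` {i})"
      using J by (simp add: S_def H_def)
  qed
  ultimately obtain M where M: "M \<in> S" "\<And>D. D \<in> S \<Longrightarrow> M \<subseteq> D \<Longrightarrow> D = M"
    using subset_Zorn_nonempty[of S] by blast
  define B where "B i = A i - M `` {i}" for i
  have HB: "card J \<le> card (\<Union>i\<in>J. B i)" if "finite J" "J \<subseteq> I" for J
    using M(1) that by (simp add: S_def H_def B_def)
  have finB: "finite (\<Union>i\<in>J. B i)" if "finite J" "J \<subseteq> I" for J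
    using that fin by (auto simp: B_def)
  \<comment> \<open>By maximality of \<open>M\<close>, deleting \<open>x\<close> from
    \<open>B i\<close> violates Hall's condition at some finite set of indices. That set contains
    \<open>i\<close>, and \<open>J\<close> is the rest of it; the strict inequality becomes
    \<open>\<le>\<close> because \<open>i\<close> has been dropped.\<close>
  have crit: "\<exists>J. finite J \<and> J \<subseteq> I \<and> i \<notin> J \<and> card ((\<Union>j\<in>J. B j) \<union> (B i - {x})) \<le> card J"
    if i: "i \<in> I" and x: "x \<in> B i" for i x
  proof -
    have "insert (i, x) M \<notin> S" using M(2)[of "insert (i, x) M"] x by (auto simp: B_def)
    then obtain J where J: "finite J" "J \<subseteq> I"
      "card (\<Union>j\<in>J. A j - insert (i, x) M `` {j}) < card J"
      by (auto simp: S_def H_def not_le)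
    have e: "A j - insert (i, x) M `` {j} = (if j = i then B i - {x} else B j)" for j
      by (auto simp: B_def)
    have iJ: "i \<in> J"
    proof (rule ccontr)
      assume "i \<notin> J"
      then have "(\<Union>j\<in>J. A j - insert (i, x) M `` {j}) = (\<Union>j\<in>J. B j)" unfolding e by auto
      then show False using J HB[of J] by simp
    qed
    have "(\<Union>j\<in>J. A j - insert (i, x) M `` {j}) = (\<Union>j\<in>J - {i}. B j) \<union> (B i - {x})"
      unfolding e using iJ by auto
    moreover have "card J = Suc (card (J - {i}))" using J(1) iJ by (metis card.remove)
    ultimately show ?thesis using J by (intro exI[of _ "J - {i}"]) auto
  qed
  have uniq: "x = y" if i: "i \<in> I" and xy: "x \<in> B i" "y \<in> B i" for i x y
  proof (rule ccontr)
    assume ne: "x \<noteq> y"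
    obtain J where J: "finite J" "J \<subseteq> I" "i \<notin> J" "card ((\<Union>j\<in>J. B j) \<union> (B i - {x})) \<le> card J"
      using crit[OF i xy(1)] by blast
    obtain K where K: "finite K" "K \<subseteq> I" "i \<notin> K" "card ((\<Union>j\<in>K. B j) \<union> (B i - {y})) \<le> card K"
      using crit[OF i xy(2)] by blast
    let ?U = "(\<Union>j\<in>J. B j) \<union> (B i - {x})" and ?V = "(\<Union>j\<in>K. B j) \<union> (B i - {y})"
    have fUV: "finite ?U" "finite ?V" using finB J K finB[of "{i}"] i by auto
    \<comment> \<open>Since \<open>x\<close> and \<open>y\<close> differ, each element of
      \<open>B i\<close> survives one of the two deletions, so the union loses nothing. It meets
      Hall's bound with the extra index \<open>i\<close>, which contradicts the bounds on
      \<open>?U\<close> and \<open>?V\<close> after inclusion-exclusion.\<close>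
    have "?U \<union> ?V = (\<Union>j\<in>insert i (J \<union> K). B j)" using ne by auto
    moreover have "card (insert i (J \<union> K)) \<le> card (\<Union>j\<in>insert i (J \<union> K). B j)"
      using J K i by (intro HB) auto
    ultimately have 1: "Suc (card (J \<union> K)) \<le> card (?U \<union> ?V)" using J K by simp
    have "card (J \<inter> K) \<le> card (\<Union>j\<in>J \<inter> K. B j)" using J K by (intro HB) auto
    also have "\<dots> \<le> card (?U \<inter> ?V)" using fUV by (intro card_mono) auto
    finally have 2: "card (J \<inter> K) \<le> card (?U \<inter> ?V)" .
    show False
      using 1 2 J(4) K(4) card_Un_Int[OF fUV] card_Un_Int[OF J(1) K(1)] by linarith
  qed
  define f where "f i = (SOME x. x \<in> B i)" for i
  have f: "f i \<in> B i" if "i \<in> I" for i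
  proof -
    have "B i \<noteq> {}" using HB[of "{i}"] that by auto
    then show ?thesis unfolding f_def by (simp add: some_in_eq)
  qed
  have Bf: "B i = {f i}" if "i \<in> I" for i using f uniq that by blast
  have "inj_on f I"
  proof (rule inj_onI, rule ccontr)
    fix i j assume "i \<in> I" "j \<in> I" "f i = f j" "i \<noteq> j"
    then show False using HB[of "{i, j}"] Bf by simp
  qed
  then show thesis using that f by (auto simp: B_def)
qed

section \<open>From an invariant mean to almost invariant finite sets\<close>

lemma finitely_additive_UN:
  fixes m :: "'a set \<Rightarrow> real"
  assumes "finite I" "disjoint_family_on A I" "\<And>i. i \<in> I \<Longrightarrow> A i \<subseteq> \<Omega>"
    and add: "\<And>A B. A \<subseteq> \<Omega> \<Longrightarrow> B \<subseteq> \<Omega> \<Longrightarrow> A \<inter> B = {} \<Longrightarrow> m (A \<union> B) = m A + m B"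
  shows "m (\<Union>i\<in>I. A i) = (\<Sum>i\<in>I. m (A i))"
  using assms(1-3)
proof (induction I)
  case empty
  then show ?case using add[of "{}" "{}"] by simp
next
  case (insert i I)
  have "A i \<inter> (\<Union>j\<in>I. A j) = {}"
    using insert.prems(1) insert.hyps(2) by (fastforce simp: disjoint_family_on_def)
  then have "m (A i \<union> (\<Union>j\<in>I. A j)) = m (A i) + m (\<Union>j\<in>I. A j)"
    using insert.prems(2) by (intro add) auto
  moreover have "m (\<Union>i\<in>I. A i) = (\<Sum>i\<in>I. m (A i))"
    using insert.prems by (intro insert.IH) (auto simp: disjoint_family_on_def)
  ultimately show ?case using insert.hyps by simp
qed

text \<open>A set that doubles every finite set yields, by the marriage theorem, two injections with
  disjoint images whose displacements are bounded; this contradicts the invariant mean.\<close>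

lemma amenable_not_doubling:
  fixes Q (structure)
  assumes am: "amenable Q" and M: "finite M" "M \<subseteq> carrier Q"
  obtains F where "finite F" "F \<subseteq> carrier Q" "card (M <#> F) < 2 * card F"
proof (rule ccontr)
  note F = that
  assume "\<not> thesis"
  then have dbl: "2 * card F \<le> card (M <#> F)" if "finite F" "F \<subseteq> carrier Q" for F
    using that F not_le by blast
  obtain m :: "'a set \<Rightarrow> real" where m': "(\<forall>A \<subseteq> carrier Q. 0 \<le> m A) \<and> m (carrier Q) = 1 \<and>
       (\<forall>A \<subseteq> carrier Q. \<forall>B \<subseteq> carrier Q. A \<inter> B = {} \<longrightarrow> m (A \<union> B) = m A + m B) \<and>
       (\<forall>g \<in> carrier Q. \<forall>A \<subseteq> carrier Q. m (g <# A) = m A)"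
    using am unfolding amenable_def by (elim conjE exE) (rule that, intro conjI)
  have m: "\<And>A. A \<subseteq> carrier Q \<Longrightarrow> 0 \<le> m A" "m (carrier Q) = 1"
    "\<And>A B. A \<subseteq> carrier Q \<Longrightarrow> B \<subseteq> carrier Q \<Longrightarrow> A \<inter> B = {} \<Longrightarrow> m (A \<union> B) = m A + m B"
    "\<And>g A. g \<in> carrier Q \<Longrightarrow> A \<subseteq> carrier Q \<Longrightarrow> m (g <# A) = m A"
    using m' by blast+
  interpret group Q using am by (simp add: amenable_def)
  define I where "I = carrier Q \<times> (UNIV :: bool set)"
  have MF: "M <#> F = (\<Union>q\<in>F. (\<lambda>k. k \<otimes> q) ` M)" for F by (auto simp: set_mult_def)
  obtain f where f: "inj_on f I" "\<And>i. i \<in> I \<Longrightarrow> f i \<in> (\<lambda>k. k \<otimes> fst i) ` M"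
  proof (rule hall_marriage[of I "\<lambda>i. (\<lambda>k. k \<otimes> fst i) ` M"])
    fix J assume J: "finite J" "J \<subseteq> I"
    have "J \<subseteq> fst ` J \<times> (UNIV :: bool set)" by force
    then have "card J \<le> card (fst ` J \<times> (UNIV :: bool set))" using J by (intro card_mono) auto
    also have "\<dots> = 2 * card (fst ` J)" by (simp add: card_cartesian_product)
    also have "\<dots> \<le> card (M <#> fst ` J)" using J by (intro dbl) (auto simp: I_def)
    also have "M <#> fst ` J = (\<Union>i\<in>J. (\<lambda>k. k \<otimes> fst i) ` M)" unfolding MF by simp
    finally show "card J \<le> card (\<Union>i\<in>J. (\<lambda>k. k \<otimes> fst i) ` M)" .
  qed (use M in auto)
  \<comment> \<open>\<open>P (k, e)\<close> collects the elements whose copy \<open>e\<close> is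
    moved by left multiplication with \<open>k\<close>. For fixed \<open>e\<close> these pieces
    partition the group, and their translates over all \<open>(k, e)\<close> are disjoint because
    \<open>f\<close> is injective: total mean 2 would have to fit into mean 1.\<close>
  define P where "P = (\<lambda>(k, e). {q \<in> carrier Q. f (q, e) = k \<otimes> q})"
  define N where "N = M \<times> (UNIV :: bool set)"
  have finN: "finite N" using M by (simp add: N_def)
  have fstN: "fst i \<in> carrier Q" if "i \<in> N" for i using that M by (auto simp: N_def)
  have Psub: "P i \<subseteq> carrier Q" for i by (auto simp: P_def split: prod.splits)
  have part: "(\<Sum>k\<in>M. m (P (k, e))) = 1" for e
  proof -
    have "(\<Sum>k\<in>M. m (P (k, e))) = m (\<Union>k\<in>M. P (k, e))"
    proof (rule finitely_additive_UN[symmetric, where \<Omega> = "carrier Q"])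
      show "disjoint_family_on (\<lambda>k. P (k, e)) M"
        using M by (auto simp: disjoint_family_on_def P_def) (metis right_cancel subsetD)
    qed (use M Psub m in auto)
    also have "(\<Union>k\<in>M. P (k, e)) = carrier Q"
      using f(2)[of "(_, e)"] by (auto simp: P_def I_def image_iff)
    finally show ?thesis using m by simp
  qed
  have sub: "fst i <# P i \<subseteq> carrier Q" if "i \<in> N" for i
    using fstN[OF that] Psub by (rule l_coset_subset_G[rotated])
  have "2 = (\<Sum>i\<in>N. m (P i))"
  proof -
    have "(\<Sum>i\<in>N. m (P i)) = (\<Sum>k\<in>M. \<Sum>e\<in>UNIV. m (P (k, e)))"
      unfolding N_def by (simp add: sum.cartesian_product)
    also have "\<dots> = (\<Sum>k\<in>M. m (P (k, True))) + (\<Sum>k\<in>M. m (P (k, False)))"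
      by (simp add: UNIV_bool sum.distrib)
    finally show ?thesis by (simp only: part)
  qed
  also have "\<dots> = (\<Sum>i\<in>N. m (fst i <# P i))"
    using m(4) fstN Psub by (intro sum.cong) auto
  also have "\<dots> = m (\<Union>i\<in>N. fst i <# P i)"
  proof (rule finitely_additive_UN[symmetric, where \<Omega> = "carrier Q"])
    show "disjoint_family_on (\<lambda>i. fst i <# P i) N"
      unfolding disjoint_family_on_def
    proof (intro ballI impI, rule ccontr)
      fix i j assume ij: "i \<in> N" "j \<in> N" "i \<noteq> j" "(fst i <# P i) \<inter> (fst j <# P j) \<noteq> {}"
      obtain k e where i: "i = (k, e)" by (cases i)
      obtain l d where j: "j = (l, d)" by (cases j)
      obtain x y where "x \<in> P i" "y \<in> P j" "k \<otimes> x = l \<otimes> y"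
        using ij i j by (auto simp: l_coset_def)
      then have xy: "x \<in> carrier Q" "y \<in> carrier Q" "f (x, e) = k \<otimes> x" "f (y, d) = k \<otimes> x" "k \<otimes> x = l \<otimes> y"
        by (auto simp: P_def i j)
      then have "(x, e) = (y, d)" using inj_onD[OF f(1), of "(x, e)" "(y, d)"] by (simp add: I_def)
      then show False using xy ij fstN[OF ij(1)] fstN[OF ij(2)] by (simp add: i j)
    qed
  qed (use finN sub m in auto)
  also have "\<dots> \<le> 1"
  proof -
    let ?U = "\<Union>i\<in>N. fst i <# P i"
    have U: "?U \<subseteq> carrier Q" using sub by blast
    then have "m (?U \<union> (carrier Q - ?U)) = m ?U + m (carrier Q - ?U)" by (intro m(3)) auto
    moreover have "?U \<union> (carrier Q - ?U) = carrier Q" using U by blast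
    ultimately show ?thesis using m(1)[of "carrier Q - ?U"] m(2) by auto
  qed
  finally show False by simp
qed

text \<open>Without such an \<open>F\<close>, every finite set grows by the factor
  \<open>1 + \<epsilon>\<close> when multiplied by \<open>L\<close>, which is \<open>K\<close> with
  the unit added. Powers of \<open>L\<close> then multiply sizes by
  \<open>(1 + \<epsilon>) ^ n\<close>, which eventually exceeds 2, and in an amenable group no
  finite set doubles all others.\<close>

lemma amenable_folner:
  fixes Q (structure) and \<epsilon> :: real
  assumes am: "amenable Q" and K: "finite K" "K \<subseteq> carrier Q" and \<epsilon>: "0 < \<epsilon>"
  obtains F where "finite F" "F \<noteq> {}" "F \<subseteq> carrier Q"
    "\<And>k. k \<in> K \<Longrightarrow> card {f \<in> F. k \<otimes> f \<notin> F} \<le> \<epsilon> * card F"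
proof (rule ccontr)
  note folner = that
  assume nf: "\<not> thesis"
  interpret group Q using am by (simp add: amenable_def)
  define L where "L = insert \<one> K"
  have L: "finite L" "L \<subseteq> carrier Q" using K by (auto simp: L_def)
  define M where "M n = ((<#>) L ^^ n) {\<one>}" for n
  have M: "finite (M n) \<and> M n \<subseteq> carrier Q" for n
    by (induction n) (use L in \<open>auto simp: M_def set_mult_def\<close>)
  have grow: "(1 + \<epsilon>) * card F \<le> card (L <#> F)" if F: "finite F" "F \<subseteq> carrier Q" for F
  proof (cases "F = {}")
    case False
    then obtain k where k: "k \<in> K" "\<not> card {f \<in> F. k \<otimes> f \<notin> F} \<le> \<epsilon> * card F"
      using nf folner[OF F(1) _ F(2)] by blast
    let ?E = "{f \<in> F. k \<otimes> f \<notin> F}"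
    \<comment> \<open>The unit in \<open>L\<close> keeps \<open>F\<close>, and \<open>k\<close> adds
      the points that it moves out of \<open>F\<close>.\<close>
    have "F \<union> (\<lambda>f. k \<otimes> f) ` ?E \<subseteq> L <#> F"
      using k F by (force simp: set_mult_def L_def)
    moreover have "finite (L <#> F)" using L F by (auto simp: set_mult_def)
    ultimately have "card (F \<union> (\<lambda>f. k \<otimes> f) ` ?E) \<le> card (L <#> F)" by (rule card_mono[rotated])
    moreover have "card (F \<union> (\<lambda>f. k \<otimes> f) ` ?E) = card F + card ((\<lambda>f. k \<otimes> f) ` ?E)"
      using F by (intro card_Un_disjoint) auto
    moreover have "card ((\<lambda>f. k \<otimes> f) ` ?E) = card ?E"
      using F K k by (intro card_image inj_onI) (auto simp: subset_eq)
    ultimately have "real (card F) + card ?E \<le> card (L <#> F)" by linarith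
    then show ?thesis using k(2) by (simp add: algebra_simps)
  qed (use \<epsilon> in simp)
  have pow: "(1 + \<epsilon>) ^ n * card F \<le> card (M n <#> F)" if F: "finite F" "F \<subseteq> carrier Q" for n F
  proof (induction n)
    case 0
    have "M 0 <#> F = F" using F by (force simp: M_def set_mult_def)
    then show ?case by simp
  next
    case (Suc n)
    have "finite (M n <#> F)" "M n <#> F \<subseteq> carrier Q"
      using M[of n] F by (auto simp: set_mult_def)
    then have "(1 + \<epsilon>) * card (M n <#> F) \<le> card (L <#> (M n <#> F))" by (rule grow)
    also have "L <#> (M n <#> F) = M (Suc n) <#> F"
      using set_mult_assoc[of L "M n" F] L M[of n] F by (simp add: M_def)
    finally have "(1 + \<epsilon>) * card (M n <#> F) \<le> card (M (Suc n) <#> F)" .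
    moreover have "(1 + \<epsilon>) * ((1 + \<epsilon>) ^ n * card F) \<le> (1 + \<epsilon>) * card (M n <#> F)"
      using Suc \<epsilon> by (intro mult_left_mono) auto
    ultimately show ?case by (simp add: algebra_simps)
  qed
  obtain n where n: "2 < (1 + \<epsilon>) ^ n" using real_arch_pow[of "1 + \<epsilon>" 2] \<epsilon> by auto
  obtain F where F: "finite F" "F \<subseteq> carrier Q" "card (M n <#> F) < 2 * card F"
    using amenable_not_doubling[OF am] M[of n] by blast
  have "2 * real (card F) \<le> (1 + \<epsilon>) ^ n * card F" using n by (intro mult_right_mono) auto
  then show False using pow[OF F(1,2), of n] F(3) by linarith
qed

section \<open>Almost equivariant maps\<close>

locale pmp_system =
  fixes G (structure) and M :: "'x measure" and a :: "'g \<Rightarrow> 'x \<Rightarrow> 'x"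
  assumes pmp: "pmp_action G M a"

sublocale pmp_system \<subseteq> prob_space M
  using pmp by (simp add: pmp_action_def)

sublocale pmp_system \<subseteq> group_action G "space M" a
  using pmp by (simp add: pmp_action_def)

sublocale pmp_system \<subseteq> group G
  using group_hom by (simp add: group_hom_def)

context pmp_system
begin

lemma act_measurable: "g \<in> carrier G \<Longrightarrow> a g \<in> measurable M M"
  using pmp by (simp add: pmp_action_def)

lemma act_closed: "g \<in> carrier G \<Longrightarrow> x \<in> space M \<Longrightarrow> a g x \<in> space M"
  by (rule element_image[OF _ _ refl])

lemma act_mult: "g \<in> carrier G \<Longrightarrow> h \<in> carrier G \<Longrightarrow> x \<in> space M \<Longrightarrow> a g (a h x) = a (g \<otimes> h) x"
  by (simp add: composition_rule)

lemma act_one: "x \<in> space M \<Longrightarrow> a \<one> x = x"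
  using fun_cong[OF id_eq_one, of x] by simp

lemma act_pred:
  assumes "g \<in> carrier G" "{x \<in> space M. P x} \<in> sets M"
  shows "{x \<in> space M. P (a g x)} \<in> sets M"
    and "measure M {x \<in> space M. P (a g x)} = measure M {x \<in> space M. P x}"
proof -
  have e: "{x \<in> space M. P (a g x)} = a g -` {x \<in> space M. P x} \<inter> space M"
    using act_closed assms by auto
  show "{x \<in> space M. P (a g x)} \<in> sets M"
    unfolding e by (rule measurable_sets[OF act_measurable]) fact+
  have "measure M {x \<in> space M. P x} = measure (distr M M (a g)) {x \<in> space M. P x}"
    using pmp assms by (simp add: pmp_action_def)
  also have "\<dots> = measure M (a g -` {x \<in> space M. P x} \<inter> space M)"
    by (rule measure_distr[OF act_measurable]) fact+
  finally show "measure M {x \<in> space M. P (a g x)} = measure M {x \<in> space M. P x}"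
    unfolding e by simp
qed

lemma act_image:
  assumes "g \<in> carrier G" "A \<subseteq> space M"
  shows "a g ` A = {x \<in> space M. a (inv g) x \<in> A}"
proof (intro equalityI subsetI)
  fix x assume "x \<in> a g ` A"
  then obtain y where "y \<in> A" "x = a g y" by blast
  then show "x \<in> {x \<in> space M. a (inv g) x \<in> A}"
    using assms by (auto simp: act_mult act_one act_closed subset_eq)
next
  fix x assume "x \<in> {x \<in> space M. a (inv g) x \<in> A}"
  moreover from this have "x = a g (a (inv g) x)" using assms by (simp add: act_mult act_one)
  ultimately show "x \<in> a g ` A" by blast
qed

end

section \<open>Measurable colourings of free actions\<close>

text \<open>Balls around the points of a countable dense set, with radii 1/(n+1), suffice: take a
  radius below half the distance from \<open>x\<close> to \<open>y\<close> and a centre within that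
  radius of \<open>x\<close>.\<close>

lemma standard_borel_separating:
  assumes "standard_borel M"
  obtains U :: "nat \<Rightarrow> 'x set" where "\<And>n. U n \<in> sets (M :: 'x measure)"
    "\<And>x y. x \<in> space M \<Longrightarrow> y \<in> space M \<Longrightarrow> x \<noteq> y \<Longrightarrow> \<exists>n. x \<in> U n \<and> y \<notin> U n"
proof -
  obtain T where T: "topspace T = space M" "completely_metrizable_space T" "separable_space T"
      "sets M = sigma_sets (topspace T) {U. openin T U}"
    using assms by (auto simp: standard_borel_def)
  obtain S d where "Metric_space S d" and Td: "T = Metric_space.mtopology S d"
    using T(2) by (auto simp: completely_metrizable_space_def)
  interpret Metric_space S d by fact
  have S: "S = space M" using T(1) Td by simp
  obtain C where C: "countable C" "C \<subseteq> S" "mtopology closure_of C = S"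
    using T(3) by (auto simp: separable_space_def Td)
  define U where "U = (\<lambda>n. mball (from_nat_into C (fst (prod_decode n)))
    (inverse (real (Suc (snd (prod_decode n))))))"
  show thesis
  proof (rule that)
    show "U n \<in> sets M" for n
      unfolding T(4) U_def Td by (intro sigma_sets.Basic) simp
    fix x y assume xy: "x \<in> space M" "y \<in> space M" "x \<noteq> y"
    then have "0 < d x y / 2" using S by simp
    then obtain n where n: "inverse (real (Suc n)) < d x y / 2"
      using reals_Archimedean by blast
    have "x \<in> mtopology closure_of C" using xy C S by simp
    then obtain z where z: "z \<in> C" "d x z < inverse (real (Suc n))"
      by (auto simp: metric_closure_of in_mball dest!: spec[of _ "inverse (real (Suc n))"])
    obtain k where k: "from_nat_into C k = z"
      using C(1) z(1) by (metis from_nat_into_to_nat_on)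
    have zS: "z \<in> S" "x \<in> S" "y \<in> S" using C z xy S by auto
    have "d x y \<le> d x z + d z y" using zS by (intro triangle) auto
    then have "\<not> d z y < inverse (real (Suc n))" using z n by linarith
    then have "x \<in> U (prod_encode (k, n)) \<and> y \<notin> U (prod_encode (k, n))"
      using z k zS commute[of x z] by (simp add: U_def)
    then show "\<exists>n. x \<in> U n \<and> y \<notin> U n" by blast
  qed
qed

text \<open>For a single \<open>g\<close> the colour of \<open>x\<close> is the first
  \<open>n\<close> with \<open>x\<close> in \<open>U n\<close> and \<open>a g x\<close> outside
  \<open>U n\<close>; equal colours at \<open>x\<close> and \<open>a g x\<close> would put
  \<open>a g x\<close> both inside and outside of \<open>U n\<close>. The colours for the elements
  of \<open>H\<close> are joined by pairing. Colour classes later serve as bases of tiles, whose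
  translates have to be disjoint.\<close>

lemma (in pmp_system) free_coloring:
  assumes "finite H" "H \<subseteq> carrier G"
    and free: "\<And>g x. g \<in> H \<Longrightarrow> x \<in> space M \<Longrightarrow> a g x \<noteq> x"
  obtains \<theta> :: "'x \<Rightarrow> nat" where "\<theta> \<in> measurable M (count_space UNIV)"
    "\<And>g x. g \<in> H \<Longrightarrow> x \<in> space M \<Longrightarrow> \<theta> (a g x) \<noteq> \<theta> x"
proof -
  obtain U :: "nat \<Rightarrow> 'x set" where U: "\<And>n. U n \<in> sets M"
    "\<And>x y. x \<in> space M \<Longrightarrow> y \<in> space M \<Longrightarrow> x \<noteq> y \<Longrightarrow> \<exists>n. x \<in> U n \<and> y \<notin> U n"
    using standard_borel_separating pmp unfolding pmp_action_def by metis
  note [measurable] = U(1)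
  have "\<exists>\<theta> :: 'x \<Rightarrow> nat. \<theta> \<in> measurable M (count_space UNIV) \<and>
      (\<forall>g\<in>H. \<forall>x\<in>space M. \<theta> (a g x) \<noteq> \<theta> x)"
    using assms
  proof (induction H)
    case empty
    show ?case by (intro exI[of _ "\<lambda>_. 0"]) simp
  next
    case (insert g H)
    obtain \<theta> :: "'x \<Rightarrow> nat" where [measurable]: "\<theta> \<in> measurable M (count_space UNIV)"
      and \<theta>: "\<And>g x. g \<in> H \<Longrightarrow> x \<in> space M \<Longrightarrow> \<theta> (a g x) \<noteq> \<theta> x"
      using insert by auto
    have g: "g \<in> carrier G" using insert.prems by simp
    note [measurable] = act_measurable[OF g]
    define \<tau> where "\<tau> x = (LEAST n. x \<in> U n \<and> a g x \<notin> U n)" for x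
    have [measurable]: "\<tau> \<in> measurable M (count_space UNIV)" unfolding \<tau>_def by measurable
    have \<tau>: "x \<in> U (\<tau> x) \<and> a g x \<notin> U (\<tau> x)" if "x \<in> space M" for x
      unfolding \<tau>_def by (rule LeastI_ex) (use U(2) insert.prems(2)[of g x] act_closed[OF g] that in force)
    have "\<tau> (a g x) \<noteq> \<tau> x" if "x \<in> space M" for x
      using \<tau>[OF that] \<tau>[OF act_closed[OF g that]] by metis
    moreover have "(\<lambda>x. prod_encode (\<tau> x, \<theta> x)) \<in> measurable M (count_space UNIV)"
      by (rule measurable_compose_countable[where f = "\<lambda>i x. prod_encode (i, \<theta> x)" and g = \<tau>]) auto
    ultimately show ?case
      using \<theta> by (intro exI[of _ "\<lambda>x. prod_encode (\<tau> x, \<theta> x)"]) auto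
  qed
  then show thesis using that by blast
qed

section \<open>Greedy tilings for a free action of the quotient\<close>

text \<open>By \<open>fixes_iff\<close> the kernel of \<open>q\<close> acts trivially and the
  quotient freely. The quotient is given no action of its own: by \<open>act_cong\<close>,
  \<open>a g x\<close> depends on \<open>g\<close> only through \<open>q g\<close>, so
  \<open>a (rep f)\<close> stands for the action of \<open>f\<close>.\<close>

locale pmp_quotient = pmp_system G M a + q: group_hom G Q q
  for G (structure) and M :: "'x measure" and a :: "'g \<Rightarrow> 'x \<Rightarrow> 'x"
    and Q (structure) and q :: "'g \<Rightarrow> 'q" +
  assumes surj: "q ` carrier G = carrier Q"
    and fixes_iff: "\<And>g x. g \<in> carrier G \<Longrightarrow> x \<in> space M \<Longrightarrow> a g x = x \<longleftrightarrow> q g = \<one>\<^bsub>Q\<^esub>"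
begin

definition rep :: "'q \<Rightarrow> 'g" where "rep f = inv_into (carrier G) q f"

lemma rep: "f \<in> carrier Q \<Longrightarrow> rep f \<in> carrier G" "f \<in> carrier Q \<Longrightarrow> q (rep f) = f"
  using surj by (auto simp: rep_def inv_into_into f_inv_into_f)

lemma act_cong:
  assumes "g \<in> carrier G" "h \<in> carrier G" "q g = q h" "x \<in> space M"
  shows "a g x = a h x"
proof -
  have "a (inv h \<otimes>\<^bsub>G\<^esub> g) x = x"
    using assms by (subst fixes_iff) auto
  then have "a h (a (inv h \<otimes>\<^bsub>G\<^esub> g) x) = a h x" by simp
  then show ?thesis using assms by (simp add: act_mult m_assoc[symmetric])
qed

text \<open>The translate f B under the induced action of the quotient: slot \<open>f\<close> of the
  tiles with base points in \<open>B\<close>.\<close>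

definition level :: "'x set \<Rightarrow> 'q \<Rightarrow> 'x set" where
  "level B f = {x \<in> space M. a (inv (rep f)) x \<in> B}"

definition uncovered :: "'q set \<Rightarrow> ('q \<Rightarrow> 'x set) \<Rightarrow> 'x set" where
  "uncovered F E = space M - (\<Union>f\<in>F. E f)"

text \<open>\<open>E f\<close> is the part of the space labelled \<open>f\<close>. A pair of
  uncovered points is no defect, so the empty family has none and can start the iteration. A pair
  with exactly one uncovered point is a defect, so the cut made when a new tile is truncated has
  been paid for already.\<close>

definition defect :: "'q set \<Rightarrow> ('q \<Rightarrow> 'x set) \<Rightarrow> 'g \<Rightarrow> 'x set" where
  "defect F E k = {x \<in> space M.
     \<not> (\<exists>f\<in>F. x \<in> E f \<and> q k \<otimes>\<^bsub>Q\<^esub> f \<in> F \<and> a k x \<in> E (q k \<otimes>\<^bsub>Q\<^esub> f)) \<and>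
     \<not> (x \<in> uncovered F E \<and> a k x \<in> uncovered F E)}"

lemma level_sets: "B \<in> sets M \<Longrightarrow> f \<in> carrier Q \<Longrightarrow> level B f \<in> sets M"
  unfolding level_def by (rule act_pred) (auto simp: rep)

lemma level_translate:
  assumes "k \<in> carrier G" "f \<in> carrier Q" "x \<in> level B f"
  shows "a k x \<in> level B (q k \<otimes>\<^bsub>Q\<^esub> f)"
proof -
  have x: "x \<in> space M" using assms by (simp add: level_def)
  have "a (inv (rep (q k \<otimes>\<^bsub>Q\<^esub> f))) (a k x) = a (inv (rep (q k \<otimes>\<^bsub>Q\<^esub> f)) \<otimes>\<^bsub>G\<^esub> k) x"
    using assms x by (simp add: act_mult rep)
  also have "\<dots> = a (inv (rep f)) x"
    using assms x by (intro act_cong) (auto simp: rep q.H.inv_mult_group q.H.m_assoc)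
  finally show ?thesis using assms x by (simp add: level_def act_closed)
qed

lemma uncovered_sets: "finite F \<Longrightarrow> (\<And>f. f \<in> F \<Longrightarrow> E f \<in> sets M) \<Longrightarrow> uncovered F E \<in> sets M"
  unfolding uncovered_def by auto

lemma defect_sets:
  assumes "finite F" "\<And>f. f \<in> F \<Longrightarrow> E f \<in> sets M" "k \<in> carrier G"
  shows "defect F E k \<in> sets M"
proof -
  have "defect F E k = space M - ((\<Union>f\<in>{f\<in>F. q k \<otimes>\<^bsub>Q\<^esub> f \<in> F}. E f \<inter> (a k -` E (q k \<otimes>\<^bsub>Q\<^esub> f) \<inter> space M))
     \<union> (uncovered F E \<inter> (a k -` uncovered F E \<inter> space M)))"
    by (auto simp: defect_def)
  also have "\<dots> \<in> sets M"
    using assms by (intro sets.Diff sets.Un sets.finite_UN sets.Int measurable_sets[OF act_measurable]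
      uncovered_sets) auto
  finally show ?thesis .
qed

text \<open>Covering a set of mass m earns 2 \<epsilon> m, and the Foelner boundary of the new tile
  is charged at most twice. The value is -2 \<epsilon> for the empty family and never positive for
  positive \<epsilon>; whenever it is at least -2 \<epsilon>, the defects sum to at most 2
  \<epsilon>.\<close>

definition potential :: "real \<Rightarrow> 'g set \<Rightarrow> 'q set \<Rightarrow> ('q \<Rightarrow> 'x set) \<Rightarrow> real" where
  "potential \<epsilon> K F E = - 2 * \<epsilon> * measure M (uncovered F E) - (\<Sum>k\<in>K. measure M (defect F E k))"

text \<open>Laying new tiles over \<open>B\<close> creates defects only where \<open>k\<close> or its inverse moves a level
  out of \<open>F\<close>, hence the factor 2.\<close>

lemma potential_extend:
  assumes F: "finite F" "F \<subseteq> carrier Q" and K: "finite K" "K \<subseteq> carrier G" "\<And>k. k \<in> K \<Longrightarrow> inv k \<in> K"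
    and E: "\<And>f. f \<in> F \<Longrightarrow> E f \<in> sets M" "disjoint_family_on E F"
    and B: "B \<in> sets M" "disjoint_family_on (level B) F"
  defines "A \<equiv> uncovered F E"
  defines "E' \<equiv> \<lambda>f. E f \<union> (A \<inter> level B f)"
  shows "disjoint_family_on E' F" and "\<And>f. f \<in> F \<Longrightarrow> E' f \<in> sets M"
    and "potential \<epsilon> K F E + 2 * (\<epsilon> * (\<Sum>f\<in>F. measure M (A \<inter> level B f))
      - (\<Sum>k\<in>K. \<Sum>f\<in>{f\<in>F. q k \<otimes>\<^bsub>Q\<^esub> f \<notin> F}. measure M (A \<inter> level B f))) \<le> potential \<epsilon> K F E'"
proof -
  have A: "A \<in> sets M" unfolding A_def using F E by (intro uncovered_sets) auto
  have L: "A \<inter> level B f \<in> sets M" if "f \<in> F" for f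
    using A B F that level_sets by blast
  have AE: "A \<inter> E f = {}" if "f \<in> F" for f
    using that by (auto simp: A_def uncovered_def)
  show E'd: "disjoint_family_on E' F"
    unfolding disjoint_family_on_def
  proof (intro ballI impI)
    fix f g assume fg: "f \<in> F" "g \<in> F" "f \<noteq> g"
    have "E f \<inter> E g = {}" "level B f \<inter> level B g = {}"
      using E(2) B(2) fg by (auto simp: disjoint_family_on_def)
    then show "E' f \<inter> E' g = {}"
      using AE[OF fg(1)] AE[OF fg(2)] unfolding E'_def by blast
  qed
  show E's: "E' f \<in> sets M" if "f \<in> F" for f
    unfolding E'_def using L[OF that] E(1)[OF that] by auto
  let ?bad = "\<lambda>k. {f\<in>F. q k \<otimes>\<^bsub>Q\<^esub> f \<notin> F}"
  define V where "V k = (\<Union>f\<in>?bad k. A \<inter> level B f)" for k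
  define b where "b k = (\<Sum>f\<in>?bad k. measure M (A \<inter> level B f))" for k
  have V: "V k \<in> sets M" for k unfolding V_def using L F by (intro sets.finite_UN) auto
  have Vs: "V k \<subseteq> space M" for k using V sets.sets_into_space by blast
  have Vb: "measure M (V k) \<le> b k" for k
    unfolding V_def b_def using F L by (intro finite_measure_subadditive_finite) auto
  have unc: "measure M (uncovered F E') = measure M A - (\<Sum>f\<in>F. measure M (A \<inter> level B f))"
  proof -
    have "uncovered F E' = A - (\<Union>f\<in>F. A \<inter> level B f)"
      by (auto simp: uncovered_def E'_def A_def)
    also have "measure M \<dots> = measure M A - measure M (\<Union>f\<in>F. A \<inter> level B f)"
      using A L F by (intro finite_measure_Diff sets.finite_UN) auto
    also have "measure M (\<Union>f\<in>F. A \<inter> level B f) = (\<Sum>f\<in>F. measure M (A \<inter> level B f))"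
    proof (rule finite_measure_finite_Union)
      show "disjoint_family_on (\<lambda>f. A \<inter> level B f) F"
        using B(2) unfolding disjoint_family_on_def by blast
    qed (use F L in auto)
    finally show ?thesis .
  qed
  have def: "measure M (defect F E' k) \<le> measure M (defect F E k) + b k + b (inv k)" if k: "k \<in> K" for k
  proof -
    have kG: "k \<in> carrier G" using K k by blast
    let ?W = "{x \<in> space M. a k x \<in> V (inv k)}"
    have "{x \<in> space M. x \<in> V (inv k)} = V (inv k)" using Vs by blast
    then have W: "?W \<in> sets M" "measure M ?W = measure M (V (inv k))"
      using act_pred[OF kG, of "\<lambda>x. x \<in> V (inv k)"] V by auto
    have "defect F E' k \<subseteq> (defect F E k \<union> V k) \<union> ?W"
    proof (rule subsetI, rule ccontr)
      fix x assume x: "x \<in> defect F E' k" "x \<notin> (defect F E k \<union> V k) \<union> ?W"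
      have xM: "x \<in> space M" using x by (simp add: defect_def)
      have good: "\<not> (\<exists>f\<in>F. x \<in> E' f \<and> q k \<otimes>\<^bsub>Q\<^esub> f \<in> F \<and> a k x \<in> E' (q k \<otimes>\<^bsub>Q\<^esub> f))"
        "\<not> (x \<in> uncovered F E' \<and> a k x \<in> uncovered F E')"
        using x(1) by (auto simp: defect_def)
      \<comment> \<open>A pair matched by the old labels stays matched, and any other pair with a
        covered point is an old defect. So both points lie in the uncovered part.\<close>
      have xA: "x \<in> A" "a k x \<in> A"
        using x(2) xM good(1) by (auto simp: defect_def A_def E'_def)
      then have "(\<exists>f\<in>F. x \<in> level B f) \<or> (\<exists>f\<in>F. a k x \<in> level B f)"
        using good(2) by (auto simp: uncovered_def E'_def A_def)
      then show False
      proof (elim disjE bexE)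
        fix f assume f: "f \<in> F" "x \<in> level B f"
        then have "q k \<otimes>\<^bsub>Q\<^esub> f \<in> F" using x(2) xA by (auto simp: V_def)
        moreover have "a k x \<in> level B (q k \<otimes>\<^bsub>Q\<^esub> f)" using level_translate[OF kG] f F by blast
        ultimately show False using good(1) f xA by (auto simp: E'_def)
      next
        \<comment> \<open>Here the new slot is known at the target, and \<open>inv k\<close> leads
          back to \<open>x\<close>; this accounts for the set \<open>?W\<close> and the term
          \<open>b (inv k)\<close>.\<close>
        fix f assume f: "f \<in> F" "a k x \<in> level B f"
        let ?f = "q (inv k) \<otimes>\<^bsub>Q\<^esub> f"
        have fQ: "f \<in> carrier Q" using f F by blast
        have 1: "?f \<in> F" using x(2) xA xM f by (auto simp: V_def)
        have "a (inv k) (a k x) \<in> level B ?f" using level_translate[of "inv k" f] kG f fQ by blast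
        then have 2: "x \<in> level B ?f" using kG xM by (simp add: act_mult act_one)
        have "q k \<otimes>\<^bsub>Q\<^esub> ?f = f" using kG fQ by (simp add: q.H.m_assoc[symmetric])
        then show False using good(1) 1 2 f xA by (auto simp: E'_def)
      qed
    qed
    then have "measure M (defect F E' k) \<le> measure M ((defect F E k \<union> V k) \<union> ?W)"
      using defect_sets[OF F(1) E(1) kG] V W by (intro finite_measure_mono) auto
    also have "\<dots> \<le> measure M (defect F E k \<union> V k) + measure M ?W"
      using defect_sets[OF F(1) E(1) kG] V W by (intro measure_Un_le) auto
    also have "measure M (defect F E k \<union> V k) \<le> measure M (defect F E k) + measure M (V k)"
      using defect_sets[OF F(1) E(1) kG] V by (intro measure_Un_le) auto
    finally show ?thesis using W(2) Vb[of k] Vb[of "inv k"] by linarith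
  qed
  have binv: "(\<Sum>k\<in>K. b (inv k)) = (\<Sum>k\<in>K. b k)"
  proof (rule sum.reindex_bij_witness[where i = "\<lambda>k. inv k" and j = "\<lambda>k. inv k"])
    fix k assume "k \<in> K"
    then show "inv (inv k) = k" "inv k \<in> K" "inv (inv k) = k" "inv k \<in> K" using K by auto
  qed simp
  have "(\<Sum>k\<in>K. measure M (defect F E' k)) \<le> (\<Sum>k\<in>K. measure M (defect F E k) + b k + b (inv k))"
    by (rule sum_mono) (rule def)
  also have "\<dots> = (\<Sum>k\<in>K. measure M (defect F E k)) + 2 * (\<Sum>k\<in>K. b k)"
    by (simp add: sum.distrib binv)
  finally show "potential \<epsilon> K F E + 2 * (\<epsilon> * (\<Sum>f\<in>F. measure M (A \<inter> level B f))
      - (\<Sum>k\<in>K. \<Sum>f\<in>{f\<in>F. q k \<otimes>\<^bsub>Q\<^esub> f \<notin> F}. measure M (A \<inter> level B f))) \<le> potential \<epsilon> K F E'"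
    unfolding potential_def unc b_def[symmetric] A_def[symmetric] by (simp add: algebra_simps)
qed

text \<open>By averaging, some colour class of \<open>\<theta>\<close> gains a definite amount.\<close>

lemma potential_step:
  fixes \<theta> :: "'x \<Rightarrow> nat" and \<delta> \<epsilon> :: real
  assumes F: "finite F" "F \<subseteq> carrier Q" "F \<noteq> {}"
    and K: "finite K" "K \<subseteq> carrier G" "\<And>k. k \<in> K \<Longrightarrow> inv k \<in> K"
    and folner: "\<And>k. k \<in> K \<Longrightarrow> card {f\<in>F. q k \<otimes>\<^bsub>Q\<^esub> f \<notin> F} \<le> \<delta> * card F"
    and \<delta>: "\<delta> * card K \<le> \<epsilon> / 2" and \<epsilon>: "0 < \<epsilon>"
    and \<theta>: "\<theta> \<in> measurable M (count_space UNIV)"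
      "\<And>i. disjoint_family_on (level (\<theta> -` {i} \<inter> space M)) F"
    and N: "measure M {x \<in> space M. N \<le> \<theta> x} \<le> \<epsilon> / 4"
    and E: "\<And>f. f \<in> F \<Longrightarrow> E f \<in> sets M" "disjoint_family_on E F"
    and large: "\<epsilon> \<le> measure M (uncovered F E)"
  obtains E' where "\<And>f. f \<in> F \<Longrightarrow> E' f \<in> sets M" "disjoint_family_on E' F"
    "potential \<epsilon> K F E + card F * \<epsilon>\<^sup>2 / (2 * (real N + 1)) \<le> potential \<epsilon> K F E'"
proof -
  define A where "A = uncovered F E"
  have A: "A \<in> sets M" unfolding A_def using F E by (intro uncovered_sets) auto
  define B where "B i = \<theta> -` {i} \<inter> space M" for i
  have B: "B i \<in> sets M" for i unfolding B_def using \<theta>(1) by (rule measurable_sets) simp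
  define gain where "gain i = (\<Sum>f\<in>F. measure M (A \<inter> level (B i) f))" for i
  define bad where "bad i = (\<Sum>k\<in>K. \<Sum>f\<in>{f\<in>F. q k \<otimes>\<^bsub>Q\<^esub> f \<notin> F}. measure M (A \<inter> level (B i) f))" for i
  \<comment> \<open>Write mu for the measure of \<open>A\<close>. Summed over the colours below
    \<open>N\<close>, gain minus cost is at least \<open>card F\<close> times \<epsilon> (mu -
    \<epsilon>/4) - \<epsilon> mu/2, hence at least \<open>card F * \<epsilon>\<^sup>2 / 4\<close>
    when mu is at least \<epsilon>. Some colour reaches the share \<open>\<kappa>\<close>; dividing
    by \<open>N + 1\<close> leaves room for a strict inequality.\<close>
  define \<kappa> where "\<kappa> = card F * \<epsilon>\<^sup>2 / (4 * (real N + 1))"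
  have L: "A \<inter> level (B i) f \<in> sets M" if "f \<in> F" for f i
    using A B F that level_sets by blast
  \<comment> \<open>For fixed \<open>f\<close> the levels over distinct colours are disjoint.
    Together they contain the points of \<open>A\<close> whose base has colour below
    \<open>N\<close>, so only the small tail of colours is lost.\<close>
  have tot: "(\<Sum>i<N. measure M (A \<inter> level (B i) f)) = measure M (A \<inter> {x \<in> space M. \<theta> (a (inv (rep f)) x) < N})"
    if f: "f \<in> F" for f
  proof -
    have "(\<Sum>i<N. measure M (A \<inter> level (B i) f)) = measure M (\<Union>i<N. A \<inter> level (B i) f)"
      using L[OF f] by (intro finite_measure_finite_Union[symmetric])
        (auto simp: disjoint_family_on_def level_def B_def)
    also have "(\<Union>i<N. A \<inter> level (B i) f) = A \<inter> {x \<in> space M. \<theta> (a (inv (rep f)) x) < N}"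
      using F f by (auto simp: level_def B_def act_closed rep subset_eq)
    finally show ?thesis .
  qed
  have gain: "card F * (measure M A - \<epsilon> / 4) \<le> (\<Sum>i<N. gain i)"
  proof -
    have "measure M A - \<epsilon> / 4 \<le> (\<Sum>i<N. measure M (A \<inter> level (B i) f))" if f: "f \<in> F" for f
    proof -
      let ?s = "inv (rep f)"
      have s: "?s \<in> carrier G" using F f by (auto simp: rep)
      let ?L = "{x \<in> space M. N \<le> \<theta> (a ?s x)}" and ?S = "{x \<in> space M. \<theta> (a ?s x) < N}"
      note [measurable] = \<theta>(1) act_measurable[OF s] A
      have "measure M ?L = measure M {x \<in> space M. N \<le> \<theta> x}"
        by (rule act_pred(2)[OF s, of "\<lambda>x. N \<le> \<theta> x"]) measurable
      moreover have "measure M A \<le> measure M ((A \<inter> ?S) \<union> ?L)"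
        using sets.sets_into_space[OF A] by (intro finite_measure_mono) auto
      moreover have "measure M ((A \<inter> ?S) \<union> ?L) \<le> measure M (A \<inter> ?S) + measure M ?L"
        by (intro measure_Un_le) measurable
      ultimately show ?thesis using N unfolding tot[OF f] by linarith
    qed
    then have "(\<Sum>f\<in>F. measure M A - \<epsilon> / 4) \<le> (\<Sum>f\<in>F. \<Sum>i<N. measure M (A \<inter> level (B i) f))"
      by (rule sum_mono)
    also have "\<dots> = (\<Sum>i<N. gain i)" unfolding gain_def by (rule sum.swap)
    finally show ?thesis by simp
  qed
  have bad: "(\<Sum>i<N. bad i) \<le> \<epsilon> / 2 * card F * measure M A"
  proof -
    have "(\<Sum>i<N. bad i) = (\<Sum>k\<in>K. \<Sum>f\<in>{f\<in>F. q k \<otimes>\<^bsub>Q\<^esub> f \<notin> F}. \<Sum>i<N. measure M (A \<inter> level (B i) f))"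
      unfolding bad_def by (subst sum.swap) (intro sum.cong refl, rule sum.swap)
    also have "\<dots> \<le> (\<Sum>k\<in>K. \<Sum>f\<in>{f\<in>F. q k \<otimes>\<^bsub>Q\<^esub> f \<notin> F}. measure M A)"
      using A by (intro sum_mono) (auto simp: tot intro!: finite_measure_mono)
    also have "\<dots> \<le> (\<Sum>k\<in>K. \<delta> * card F * measure M A)"
      using folner by (intro sum_mono) (simp add: mult_right_mono)
    also have "\<dots> = (\<delta> * card K) * (card F * measure M A)" by simp
    also have "\<dots> \<le> (\<epsilon> / 2) * (card F * measure M A)"
      using \<delta> by (intro mult_right_mono) auto
    finally show ?thesis by (simp add: mult.assoc)
  qed
  have cF: "0 < card F" using F by (simp add: card_gt_0_iff)
  have "\<exists>i<N. \<kappa> \<le> \<epsilon> * gain i - bad i"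
  proof (rule ccontr)
    assume "\<not> ?thesis"
    then have "(\<Sum>i<N. \<epsilon> * gain i - bad i) \<le> (\<Sum>i<N. \<kappa>)"
      by (intro sum_mono) (auto simp: not_le less_imp_le)
    also have "\<dots> < (real N + 1) * \<kappa>"
    proof -
      have "0 < \<kappa>" using cF \<epsilon> by (simp add: \<kappa>_def)
      then show ?thesis by (simp add: algebra_simps)
    qed
    also have "\<dots> = card F * \<epsilon>\<^sup>2 / 4" by (simp add: \<kappa>_def field_simps)
    finally have 1: "\<epsilon> * (\<Sum>i<N. gain i) - (\<Sum>i<N. bad i) < card F * \<epsilon>\<^sup>2 / 4"
      by (simp add: sum_subtractf sum_distrib_left)
    have "\<epsilon> * (card F * (measure M A - \<epsilon> / 4)) \<le> \<epsilon> * (\<Sum>i<N. gain i)"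
      using gain \<epsilon> by (intro mult_left_mono) auto
    moreover have "card F * \<epsilon> * \<epsilon> \<le> card F * \<epsilon> * measure M A"
      using large \<epsilon> unfolding A_def by (intro mult_left_mono) auto
    ultimately show False using 1 bad by (simp add: algebra_simps power2_eq_square)
  qed
  then obtain i where i: "\<kappa> \<le> \<epsilon> * gain i - bad i" by blast
  define E' where "E' f = E f \<union> (uncovered F E \<inter> level (B i) f)" for f
  have lev: "disjoint_family_on (level (B i)) F" using \<theta>(2) by (simp add: B_def)
  note ext = potential_extend[OF F(1,2) K E B lev, folded E'_def]
  show thesis
  proof (rule that[of E'])
    have \<kappa>2: "card F * \<epsilon>\<^sup>2 / (2 * (real N + 1)) = 2 * \<kappa>" by (simp add: \<kappa>_def field_simps)
    have 1: "potential \<epsilon> K F E + 2 * (\<epsilon> * gain i - bad i) \<le> potential \<epsilon> K F E'"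
      unfolding gain_def bad_def A_def by (rule ext(3))
    have 2: "2 * \<kappa> \<le> 2 * (\<epsilon> * gain i - bad i)" using i by simp
    show "potential \<epsilon> K F E + card F * \<epsilon>\<^sup>2 / (2 * (real N + 1)) \<le> potential \<epsilon> K F E'"
      unfolding \<kappa>2 by (rule order_trans[OF add_left_mono[OF 2] 1])
  qed (use ext in auto)
qed

text \<open>\<open>c\<close> records the slot in which a point lies. As long as much is uncovered, a
  greedy step raises the potential by a fixed amount, and the potential never exceeds 0; so at some
  stage the uncovered part is small. The potential is then no lower than at the start, which bounds
  the defects as well.\<close>

lemma almost_equivariant_map:
  assumes am: "amenable Q" and K: "finite K" "K \<subseteq> carrier G" and \<epsilon>: "0 < (\<epsilon> :: real)"
  obtains F c where "finite F" "F \<subseteq> carrier Q" "c \<in> measurable M (count_space F)"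
    "\<And>k. k \<in> K \<Longrightarrow> measure M {x \<in> space M. c (a k x) \<noteq> q k \<otimes>\<^bsub>Q\<^esub> c x} \<le> \<epsilon>"
proof -
  define K' where "K' = K \<union> (\<lambda>k. inv k) ` K"
  have K': "finite K'" "K' \<subseteq> carrier G" "\<And>k. k \<in> K' \<Longrightarrow> inv k \<in> K'" "K \<subseteq> K'"
    using K by (auto simp: K'_def)
  \<comment> \<open>Defects will contribute \<open>2 * \<eta>\<close> and the uncovered part
    \<open>\<eta>\<close>. The choice of \<open>\<delta>\<close> keeps the Foelner boundaries,
    summed over \<open>K'\<close>, within the fraction \<open>\<eta> / 2\<close> of
    \<open>F\<close>.\<close>
  define \<eta> where "\<eta> = \<epsilon> / 3"
  define \<delta> where "\<delta> = \<eta> / (2 * (real (card K') + 1))"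
  have \<eta>: "0 < \<eta>" and \<delta>: "0 < \<delta>" using \<epsilon> by (auto simp: \<eta>_def \<delta>_def)
  have \<delta>K: "\<delta> * card K' \<le> \<eta> / 2" using \<eta> by (simp add: \<delta>_def field_simps)
  obtain F where F: "finite F" "F \<noteq> {}" "F \<subseteq> carrier Q"
    and fol: "\<And>k. k \<in> q ` K' \<Longrightarrow> card {f \<in> F. k \<otimes>\<^bsub>Q\<^esub> f \<notin> F} \<le> \<delta> * card F"
    proof (rule amenable_folner[OF am, of "q ` K'" \<delta>])
    show "q ` K' \<subseteq> carrier Q" using K' by auto
  qed (use K' \<delta> in auto)
  \<comment> \<open>A point in two levels \<open>f\<close> and \<open>g\<close> over the same set
    has two base points that differ by such an element. Colours that change under all of
    \<open>H\<close> therefore give classes with disjoint levels.\<close>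
  define H where "H = (\<lambda>(f, g). inv (rep f) \<otimes>\<^bsub>G\<^esub> rep g) ` {(f, g) \<in> F \<times> F. f \<noteq> g}"
  have repF: "rep f \<in> carrier G" "q (rep f) = f" "f \<in> carrier Q" if "f \<in> F" for f
    using that F by (auto simp: rep)
  have H: "finite H" "H \<subseteq> carrier G"
  proof -
    have "{(f, g) \<in> F \<times> F. f \<noteq> g} \<subseteq> F \<times> F" by auto
    then show "finite H" unfolding H_def using F by (intro finite_imageI) (auto intro: finite_subset)
  qed (auto simp: H_def repF)
  obtain \<theta> :: "'x \<Rightarrow> nat" where \<theta>: "\<theta> \<in> measurable M (count_space UNIV)"
    "\<And>g x. g \<in> H \<Longrightarrow> x \<in> space M \<Longrightarrow> \<theta> (a g x) \<noteq> \<theta> x"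
  proof (rule free_coloring[OF H])
    fix h x assume h: "h \<in> H" and x: "x \<in> space M"
    then obtain f g where fg: "f \<in> F" "g \<in> F" "f \<noteq> g" "h = inv (rep f) \<otimes>\<^bsub>G\<^esub> rep g"
      by (auto simp: H_def)
    have "q h = inv\<^bsub>Q\<^esub> f \<otimes>\<^bsub>Q\<^esub> g" using fg by (simp add: repF)
    moreover have "inv\<^bsub>Q\<^esub> f \<otimes>\<^bsub>Q\<^esub> g \<noteq> \<one>\<^bsub>Q\<^esub>"
      using fg repF(3) q.H.inv_equality q.H.inv_inv by (metis q.H.inv_closed)
    ultimately show "a h x \<noteq> x" using h H x by (subst fixes_iff) auto
  qed (rule that)
  have lev: "disjoint_family_on (level (\<theta> -` {i} \<inter> space M)) F" for i
    unfolding disjoint_family_on_def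
  proof (intro ballI impI, rule ccontr)
    fix f g assume fg: "f \<in> F" "g \<in> F" "f \<noteq> g"
      and "level (\<theta> -` {i} \<inter> space M) f \<inter> level (\<theta> -` {i} \<inter> space M) g \<noteq> {}"
    then obtain x where x: "x \<in> space M" "\<theta> (a (inv (rep f)) x) = i" "\<theta> (a (inv (rep g)) x) = i"
      by (auto simp: level_def)
    have "inv (rep f) \<otimes>\<^bsub>G\<^esub> rep g \<in> H" using fg by (force simp: H_def)
    moreover have "a (inv (rep f) \<otimes>\<^bsub>G\<^esub> rep g) (a (inv (rep g)) x) = a (inv (rep f)) x"
      using fg x by (simp add: act_mult repF m_assoc)
    moreover have "a (inv (rep g)) x \<in> space M" using fg x by (simp add: act_closed repF)
    ultimately show False using \<theta>(2) x by metis
  qed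
  \<comment> \<open>The colouring may use infinitely many colours; a tail of small measure is given
    up so that the averaging runs over finitely many.\<close>
  obtain N where N: "measure M {x \<in> space M. N \<le> \<theta> x} \<le> \<eta> / 4"
  proof -
    let ?T = "\<lambda>n. {x \<in> space M. n \<le> \<theta> x}"
    note [measurable] = \<theta>(1)
    have "(\<lambda>n. measure M (?T n)) \<longlonglongrightarrow> measure M (\<Inter>n. ?T n)"
      by (intro finite_Lim_measure_decseq) (auto simp: decseq_def)
    moreover have "(\<Inter>n. ?T n) = {}" 
    proof (rule equals0I)
      fix x assume "x \<in> (\<Inter>n. ?T n)"
      then have "Suc (\<theta> x) \<le> \<theta> x" by blast
      then show False by simp
    qed
    ultimately have "(\<lambda>n. measure M (?T n)) \<longlonglongrightarrow> 0" by simp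
    then have "\<forall>\<^sub>F n in sequentially. measure M (?T n) < \<eta> / 4"
      using \<eta> by (intro order_tendstoD) auto
    then show thesis using that by (auto simp: eventually_sequentially intro: less_imp_le)
  qed
  define ok where "ok E \<longleftrightarrow> (\<forall>f\<in>F. E f \<in> sets M) \<and> disjoint_family_on E F" for E :: "'q \<Rightarrow> 'x set"
  have "\<exists>E. ok E \<and> - 2 * \<eta> \<le> potential \<eta> K' F E \<and> measure M (uncovered F E) < \<eta>"
  proof (rule ccontr)
    assume contra: "\<not> ?thesis"
    define \<kappa> where "\<kappa> = card F * \<eta>\<^sup>2 / (2 * (real N + 1))"
    have "0 < card F" using F by (simp add: card_gt_0_iff)
    then have \<kappa>: "0 < \<kappa>" using \<eta> by (simp add: \<kappa>_def)
    have "\<exists>E. ok E \<and> - 2 * \<eta> + n * \<kappa> \<le> potential \<eta> K' F E" for n :: nat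
    proof (induction n)
      case 0
      have "potential \<eta> K' F (\<lambda>_. {}) = - 2 * \<eta>"
      proof -
        have "uncovered F (\<lambda>_. {}) = space M" by (auto simp: uncovered_def)
        moreover have "defect F (\<lambda>_. {}) k = {}" if "k \<in> K'" for k
          using K' that by (auto simp: defect_def calculation act_closed)
        ultimately show ?thesis by (simp add: potential_def prob_space)
      qed
      then show ?case by (intro exI[of _ "\<lambda>_. {}"]) (simp add: ok_def disjoint_family_on_def)
    next
      case (Suc n)
      then obtain E where E: "ok E" "- 2 * \<eta> + n * \<kappa> \<le> potential \<eta> K' F E" by blast
      have "0 \<le> n * \<kappa>" using \<kappa> by simp
      then have large: "\<eta> \<le> measure M (uncovered F E)" using contra E by force
      obtain E' where "\<And>f. f \<in> F \<Longrightarrow> E' f \<in> sets M" "disjoint_family_on E' F"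
        "potential \<eta> K' F E + \<kappa> \<le> potential \<eta> K' F E'"
        using potential_step[OF F(1,3,2) K'(1-3) fol[OF imageI] \<delta>K \<eta> \<theta>(1) lev N _ _ large] E(1)
        unfolding \<kappa>_def ok_def by blast
      then show ?case using E(2) by (intro exI[of _ E']) (auto simp: ok_def algebra_simps)
    qed
    moreover obtain n :: nat where "2 * \<eta> < n * \<kappa>" using reals_Archimedean3[OF \<kappa>] by blast
    moreover have "potential \<eta> K' F E \<le> 0" for E
    proof -
      have "0 \<le> 2 * \<eta> * measure M (uncovered F E)" using \<eta> by simp
      moreover have "0 \<le> (\<Sum>k\<in>K'. measure M (defect F E k))" by (rule sum_nonneg) simp
      ultimately show ?thesis unfolding potential_def by linarith
    qed
    ultimately show False by (smt (verit))
  qed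
  then obtain E where E: "\<And>f. f \<in> F \<Longrightarrow> E f \<in> sets M" "disjoint_family_on E F"
    and pot: "- 2 * \<eta> \<le> potential \<eta> K' F E" and small: "measure M (uncovered F E) < \<eta>"
    by (auto simp: ok_def)
  obtain f0 where f0: "f0 \<in> F" using F by blast
  define c where "c x = (if \<exists>f\<in>F. x \<in> E f then THE f. f \<in> F \<and> x \<in> E f else f0)" for x
  have cE: "c x = f" if "f \<in> F" "x \<in> E f" for f x
  proof -
    have "(THE f. f \<in> F \<and> x \<in> E f) = f"
      using that E(2) by (intro the_equality) (auto simp: disjoint_family_on_def)
    then show ?thesis using that by (auto simp: c_def)
  qed
  have c0: "c x = f0" if "\<not> (\<exists>f\<in>F. x \<in> E f)" for x using that unfolding c_def by simp
  have cF: "c x \<in> F" for x using cE c0 f0 by metis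
  have "c \<in> measurable M (count_space F)"
  proof (rule measurable_count_space_eq2[THEN iffD2, OF F(1)], intro conjI ballI)
    show "c \<in> space M \<rightarrow> F" using cF by blast
    fix f assume f: "f \<in> F"
    have "c -` {f} \<inter> space M = E f \<union> (if f = f0 then uncovered F E else {})"
      using cE c0 f sets.sets_into_space[OF E(1)] by (auto simp: uncovered_def split: if_splits) blast+
    also have "\<dots> \<in> sets M" using f E(1) F uncovered_sets by auto
    finally show "c -` {f} \<inter> space M \<in> sets M" .
  qed
  moreover have "measure M {x \<in> space M. c (a k x) \<noteq> q k \<otimes>\<^bsub>Q\<^esub> c x} \<le> \<epsilon>" if k: "k \<in> K" for k
  proof -
    have k': "k \<in> K'" "k \<in> carrier G" using k K' by auto
    have D: "defect F E k \<in> sets M" using F E(1) k' by (intro defect_sets)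
    have U: "uncovered F E \<in> sets M" using F E(1) by (intro uncovered_sets)
    \<comment> \<open>On a pair of uncovered points \<open>c\<close> takes the default value
      \<open>f0\<close> twice, which is not equivariant in general; hence the uncovered part is
      added to the defects.\<close>
    have "{x \<in> space M. c (a k x) \<noteq> q k \<otimes>\<^bsub>Q\<^esub> c x} \<subseteq> defect F E k \<union> uncovered F E"
    proof
      fix x assume x: "x \<in> {x \<in> space M. c (a k x) \<noteq> q k \<otimes>\<^bsub>Q\<^esub> c x}"
      then have "\<not> (\<exists>f\<in>F. x \<in> E f \<and> q k \<otimes>\<^bsub>Q\<^esub> f \<in> F \<and> a k x \<in> E (q k \<otimes>\<^bsub>Q\<^esub> f))"
        using cE by fastforce
      then show "x \<in> defect F E k \<union> uncovered F E" using x by (auto simp: defect_def)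
    qed
    then have "measure M {x \<in> space M. c (a k x) \<noteq> q k \<otimes>\<^bsub>Q\<^esub> c x} \<le> measure M (defect F E k \<union> uncovered F E)"
      using D U by (intro finite_measure_mono) auto
    also have "\<dots> \<le> measure M (defect F E k) + measure M (uncovered F E)"
      using D U by (intro measure_Un_le)
    also have "measure M (defect F E k) \<le> (\<Sum>k\<in>K'. measure M (defect F E k))"
      using K' k' by (intro member_le_sum) auto
    also have "\<dots> \<le> 2 * \<eta>"
    proof -
      have "0 \<le> 2 * \<eta> * measure M (uncovered F E)" using \<eta> by simp
      then show ?thesis using pot unfolding potential_def by linarith
    qed
    finally show ?thesis using small unfolding \<eta>_def by linarith
  qed
  ultimately show thesis using that F by blast
qed

end

section \<open>Finite partitions and weak containment\<close>

lemma finite_valued_pred: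
  assumes "g \<in> measurable M (count_space D)" "finite D"
  shows "{x \<in> space M. P (g x)} \<in> sets M"
proof -
  have "{x \<in> space M. P (g x)} = g -` (D \<inter> Collect P) \<inter> space M"
    using measurable_space[OF assms(1)] by auto
  also have "\<dots> \<in> sets M" by (rule measurable_sets[OF assms(1)]) auto
  finally show ?thesis .
qed

lemma finite_valued_measure_diff:
  fixes e :: real
  assumes "finite_measure M" "finite_measure N" "finite D"
    and g: "g \<in> measurable M (count_space D)" and h: "h \<in> measurable N (count_space D)"
    and e: "\<And>d. d \<in> D \<Longrightarrow> \<bar>measure M {x \<in> space M. g x = d} - measure N {x \<in> space N. h x = d}\<bar> \<le> e"
  shows "\<bar>measure M {x \<in> space M. P (g x)} - measure N {x \<in> space N. P (h x)}\<bar> \<le> card D * e"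
proof -
  interpret M: finite_measure M by fact
  interpret N: finite_measure N by fact
  let ?T = "D \<inter> Collect P"
  have "{x \<in> space M. P (g x)} = (\<Union>d\<in>?T. {x \<in> space M. g x = d})"
    using measurable_space[OF g] by auto
  also have "measure M \<dots> = (\<Sum>d\<in>?T. measure M {x \<in> space M. g x = d})"
    using assms finite_valued_pred[OF g]
    by (intro M.finite_measure_finite_Union) (auto simp: disjoint_family_on_def)
  finally have 1: "measure M {x \<in> space M. P (g x)} = (\<Sum>d\<in>?T. measure M {x \<in> space M. g x = d})" .
  have "{x \<in> space N. P (h x)} = (\<Union>d\<in>?T. {x \<in> space N. h x = d})"
    using measurable_space[OF h] by auto
  also have "measure N \<dots> = (\<Sum>d\<in>?T. measure N {x \<in> space N. h x = d})"
    using assms finite_valued_pred[OF h]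
    by (intro N.finite_measure_finite_Union) (auto simp: disjoint_family_on_def)
  finally have 2: "measure N {x \<in> space N. P (h x)} = (\<Sum>d\<in>?T. measure N {x \<in> space N. h x = d})" .
  have "\<bar>measure M {x \<in> space M. P (g x)} - measure N {x \<in> space N. P (h x)}\<bar>
      \<le> (\<Sum>d\<in>?T. \<bar>measure M {x \<in> space M. g x = d} - measure N {x \<in> space N. h x = d}\<bar>)"
    unfolding 1 2 sum_subtractf[symmetric] by (rule sum_abs)
  also have "\<dots> \<le> (\<Sum>d\<in>D. \<bar>measure M {x \<in> space M. g x = d} - measure N {x \<in> space N. h x = d}\<bar>)"
    using assms by (intro sum_mono2) auto
  also have "\<dots> \<le> (\<Sum>d\<in>D. e)" using e by (rule sum_mono)
  finally show ?thesis by simp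
qed

lemma measurable_finite_tuple:
  assumes "finite S" "finite W" "\<And>s. s \<in> S \<Longrightarrow> h s \<in> measurable M (count_space W)"
  shows "(\<lambda>x. \<lambda>s\<in>S. h s x) \<in> measurable M (count_space (S \<rightarrow>\<^sub>E W))"
proof (rule measurable_count_space_eq2[THEN iffD2], goal_cases)
  case 1
  show ?case using assms by (intro finite_PiE)
next
  case 2
  show ?case
  proof (intro conjI ballI)
    show "(\<lambda>x. \<lambda>s\<in>S. h s x) \<in> space M \<rightarrow> (S \<rightarrow>\<^sub>E W)"
      using measurable_space[OF assms(3)] by fastforce
    fix \<pi> assume \<pi>: "\<pi> \<in> S \<rightarrow>\<^sub>E W"
    have "(\<lambda>x. \<lambda>s\<in>S. h s x) -` {\<pi>} \<inter> space M = {x \<in> space M. \<forall>s\<in>S. h s x = \<pi> s}"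
      using \<pi> by (auto simp: PiE_def extensional_def restrict_def fun_eq_iff)
    also have "\<dots> \<in> sets M"
      using assms by (intro sets.sets_Collect_finite_All finite_valued_pred) auto
    finally show "(\<lambda>x. \<lambda>s\<in>S. h s x) -` {\<pi>} \<inter> space M \<in> sets M" .
  qed
qed

lemma measurable_finite_pair:
  assumes "finite V" "finite W" "g \<in> measurable M (count_space V)" "h \<in> measurable M (count_space W)"
  shows "(\<lambda>x. (g x, h x)) \<in> measurable M (count_space (V \<times> W))"
proof (rule measurable_count_space_eq2[THEN iffD2], goal_cases)
  case 2
  show ?case
  proof (intro conjI ballI)
    show "(\<lambda>x. (g x, h x)) \<in> space M \<rightarrow> V \<times> W"
      using measurable_space[OF assms(3)] measurable_space[OF assms(4)] by auto
    fix d assume "d \<in> V \<times> W"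
    have "(\<lambda>x. (g x, h x)) -` {d} \<inter> space M
        = {x \<in> space M. g x = fst d} \<inter> {x \<in> space M. h x = snd d}"
      by auto
    also have "\<dots> \<in> sets M"
      using finite_valued_pred[OF assms(3,1)] finite_valued_pred[OF assms(4,2)] by (rule sets.Int)
    finally show "(\<lambda>x. (g x, h x)) -` {d} \<inter> space M \<in> sets M" .
  qed
qed (use assms in simp)

lemma measurable_finite_comp:
  assumes "g \<in> measurable M (count_space V)" "\<And>x. x \<in> V \<Longrightarrow> h x \<in> W"
  shows "(\<lambda>x. h (g x)) \<in> measurable M (count_space W)"
  by (rule measurable_compose[OF assms(1)]) (use assms(2) in auto)

text \<open>Passes from initial segments of the natural numbers to arbitrary finite label sets, and
  from single patterns to arbitrary events. A single \<open>\<alpha>'\<close> serves every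
  \<open>P\<close>: there are \<open>card D\<close> atoms, each approximated within
  \<open>\<delta>\<close>, and every event is a union of atoms.\<close>

lemma ec_factor_map_finite_labels:
  fixes f :: "'z \<Rightarrow> 'x" and W :: "'w set" and V :: "'v set"
  assumes ec: "ec_factor_map G Z b X a f"
    and W: "finite W" "\<alpha> \<in> measurable Z (count_space W)"
    and V: "finite V" "\<beta> \<in> measurable X (count_space V)"
    and S: "finite S" "S \<subseteq> carrier G" and \<epsilon>: "0 < (\<epsilon> :: real)"
  obtains \<alpha>' where "\<alpha>' \<in> measurable X (count_space W)"
    "\<And>P. \<bar>measure Z {z \<in> space Z. P (\<lambda>s\<in>S. \<alpha> (b (inv\<^bsub>G\<^esub> s) z)) (\<beta> (f z))}
      - measure X {x \<in> space X. P (\<lambda>s\<in>S. \<alpha>' (a (inv\<^bsub>G\<^esub> s) x)) (\<beta> x)}\<bar> \<le> \<epsilon>"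
proof -
  have fm: "factor_map G Z b X a f" using ec by (simp add: ec_factor_map_def)
  interpret Z: pmp_system G Z b using fm by unfold_locales (simp add: factor_map_def)
  interpret X: pmp_system G X a using fm by unfold_locales (simp add: factor_map_def)
  have f: "f \<in> measurable Z X" using fm by (simp add: factor_map_def)
  obtain w where w: "bij_betw w {..<card W} W"
    using ex_bij_betw_nat_finite[OF W(1)] atLeast0LessThan by metis
  obtain v where v: "bij_betw v {..<card V} V"
    using ex_bij_betw_nat_finite[OF V(1)] atLeast0LessThan by metis
  define w' where "w' = the_inv_into {..<card W} w"
  define v' where "v' = the_inv_into {..<card V} v"
  have w': "w' y < card W" "w (w' y) = y" if "y \<in> W" for y
    using w that f_the_inv_into_f_bij_betw[OF w, of y] the_inv_into_into[of w "{..<card W}" y "{..<card W}"]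
    by (auto simp: w'_def bij_betw_def)
  have v': "v' y < card V" "v (v' y) = y" if "y \<in> V" for y
    using v that f_the_inv_into_f_bij_betw[OF v, of y] the_inv_into_into[of v "{..<card V}" y "{..<card V}"]
    by (auto simp: v'_def bij_betw_def)
  define D where "D = (S \<rightarrow>\<^sub>E {..<card W}) \<times> {..<card V}"
  have D: "finite D" using S by (auto simp: D_def intro: finite_PiE)
  define \<delta> where "\<delta> = \<epsilon> / (real (card D) + 1)"
  have \<delta>: "0 < \<delta>" using \<epsilon> by (simp add: \<delta>_def)
  have am: "(\<lambda>z. w' (\<alpha> z)) \<in> measurable Z (count_space {..<card W})"
    using W(2) by (rule measurable_finite_comp) (simp add: w')
  have bm: "(\<lambda>x. v' (\<beta> x)) \<in> measurable X (count_space {..<card V})"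
    using V(2) by (rule measurable_finite_comp) (simp add: v')
  obtain \<gamma> where \<gamma>: "\<gamma> \<in> measurable X (count_space {..<card W})"
    and close: "\<And>\<pi> j. \<pi> \<in> S \<rightarrow>\<^sub>E {..<card W} \<Longrightarrow> j < card V \<Longrightarrow>
      \<bar>measure Z (translates G b S (\<lambda>z. w' (\<alpha> z)) -` {\<pi>} \<inter> f -` ((\<lambda>x. v' (\<beta> x)) -` {j}) \<inter> space Z)
       - measure X (translates G a S \<gamma> -` {\<pi>} \<inter> (\<lambda>x. v' (\<beta> x)) -` {j} \<inter> space X)\<bar> < \<delta>"
    using ec[unfolded ec_factor_map_def, THEN conjunct2, rule_format, OF am bm, of S \<delta>] S \<delta> by blast
  define g where "g z = (translates G b S (\<lambda>z. w' (\<alpha> z)) z, v' (\<beta> (f z)))" for z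
  define h where "h x = (translates G a S \<gamma> x, v' (\<beta> x))" for x
  have SG: "inv\<^bsub>G\<^esub> s \<in> carrier G" if "s \<in> S" for s using S that Z.inv_closed by auto
  have gm: "g \<in> measurable Z (count_space D)"
    unfolding g_def D_def translates_def using S am bm f
    by (intro measurable_finite_pair measurable_finite_tuple measurable_compose[OF Z.act_measurable[OF SG]]
      measurable_compose[OF f]) (auto intro: finite_PiE)
  have hm: "h \<in> measurable X (count_space D)"
    unfolding h_def D_def translates_def using S \<gamma> bm
    by (intro measurable_finite_pair measurable_finite_tuple measurable_compose[OF X.act_measurable[OF SG]])
      (auto intro: finite_PiE)
  show thesis
  proof (rule that)
    show "(\<lambda>x. w (\<gamma> x)) \<in> measurable X (count_space W)"
      using \<gamma> by (rule measurable_finite_comp) (use w in \<open>auto simp: bij_betw_def\<close>)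
    fix P :: "('a \<Rightarrow> 'w) \<Rightarrow> 'v \<Rightarrow> bool"
    define P' where "P' = (\<lambda>(\<pi>, j). P (\<lambda>s\<in>S. w (\<pi> s)) (v j))"
    have "\<bar>measure Z {z \<in> space Z. P' (g z)} - measure X {x \<in> space X. P' (h x)}\<bar> \<le> card D * \<delta>"
    proof (rule finite_valued_measure_diff[OF Z.finite_measure_axioms X.finite_measure_axioms D gm hm])
      fix d assume "d \<in> D"
      then obtain \<pi> j where d: "d = (\<pi>, j)" "\<pi> \<in> S \<rightarrow>\<^sub>E {..<card W}" "j < card V" by (auto simp: D_def)
      have "{z \<in> space Z. g z = d} = translates G b S (\<lambda>z. w' (\<alpha> z)) -` {\<pi>} \<inter> f -` ((\<lambda>x. v' (\<beta> x)) -` {j}) \<inter> space Z"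
        "{x \<in> space X. h x = d} = translates G a S \<gamma> -` {\<pi>} \<inter> (\<lambda>x. v' (\<beta> x)) -` {j} \<inter> space X"
        by (auto simp: g_def h_def d)
      then show "\<bar>measure Z {z \<in> space Z. g z = d} - measure X {x \<in> space X. h x = d}\<bar> \<le> \<delta>"
        using close[OF d(2,3)] by simp
    qed
    also have "card D * \<delta> \<le> \<epsilon>" using \<epsilon> by (simp add: \<delta>_def field_simps)
    also have "{z \<in> space Z. P' (g z)} = {z \<in> space Z. P (\<lambda>s\<in>S. \<alpha> (b (inv\<^bsub>G\<^esub> s) z)) (\<beta> (f z))}"
    proof (rule Collect_cong, rule conj_cong[OF refl])
      fix z assume z: "z \<in> space Z"
      have "\<alpha> (b (inv\<^bsub>G\<^esub> s) z) \<in> W" if "s \<in> S" for s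
        using measurable_space[OF W(2)] Z.act_closed[OF SG[OF that] z] by simp
      moreover have "\<beta> (f z) \<in> V" using measurable_space[OF V(2)] measurable_space[OF f z] by simp
      ultimately show "P' (g z) \<longleftrightarrow> P (\<lambda>s\<in>S. \<alpha> (b (inv\<^bsub>G\<^esub> s) z)) (\<beta> (f z))"
        by (simp add: P'_def g_def translates_def w' v' cong: restrict_cong)
    qed
    also have "{x \<in> space X. P' (h x)} = {x \<in> space X. P (\<lambda>s\<in>S. w (\<gamma> (a (inv\<^bsub>G\<^esub> s) x))) (\<beta> x)}"
    proof (rule Collect_cong, rule conj_cong[OF refl])
      fix x assume x: "x \<in> space X"
      have "\<beta> x \<in> V" using measurable_space[OF V(2) x] by simp
      then show "P' (h x) \<longleftrightarrow> P (\<lambda>s\<in>S. w (\<gamma> (a (inv\<^bsub>G\<^esub> s) x))) (\<beta> x)"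
        by (simp add: P'_def h_def translates_def v' cong: restrict_cong)
    qed
    finally show "\<bar>measure Z {z \<in> space Z. P (\<lambda>s\<in>S. \<alpha> (b (inv\<^bsub>G\<^esub> s) z)) (\<beta> (f z))}
      - measure X {x \<in> space X. P (\<lambda>s\<in>S. w (\<gamma> (a (inv\<^bsub>G\<^esub> s) x))) (\<beta> x)}\<bar> \<le> \<epsilon>" .
  qed
qed

section \<open>Transfer of almost equivariant maps\<close>

text \<open>The sets supplied by weak containment imitate the pairwise statistics of a partition but
  need not form one. Including the identity among the group elements makes their overlaps small, and
  points outside all of them get a default label. It is enough to bound the good event from below:
  its pieces, off the overlaps, carry almost the same mass in \<open>X\<close> as in
  \<open>Y\<close>, and complements give the bound on the bad event.\<close>

lemma weak_containment_transfer:
  fixes c :: "'y \<Rightarrow> 'q" and \<sigma> :: "'g \<Rightarrow> 'q \<Rightarrow> 'q"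
  assumes X: "pmp_action G X a" and Y: "pmp_action G Y b" and wc: "weakly_contains G X a Y b"
    and c: "finite F" "c \<in> measurable Y (count_space F)"
    and K: "finite K" "K \<subseteq> carrier G" and \<epsilon>: "0 < (\<epsilon> :: real)"
  obtains c' where "c' \<in> measurable X (count_space F)"
    "\<And>k. k \<in> K \<Longrightarrow> measure X {x \<in> space X. c' (a k x) \<noteq> \<sigma> k (c' x)}
      \<le> measure Y {y \<in> space Y. c (b k y) \<noteq> \<sigma> k (c y)} + \<epsilon>"
proof -
  interpret X: pmp_system G X a using X by unfold_locales
  interpret Y: pmp_system G Y b using Y by unfold_locales
  define n where "n = card F"
  obtain h where h: "bij_betw h {..<n} F"
    using ex_bij_betw_nat_finite[OF c(1)] atLeast0LessThan unfolding n_def by metis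
  have hF: "h i \<in> F" if "i < n" for i using h that by (auto simp: bij_betw_def)
  have h_inj: "h i = h j \<longleftrightarrow> i = j" if "i < n" "j < n" for i j
    using h that by (auto simp: bij_betw_def inj_on_def)
  have h_surj: "\<exists>i<n. f = h i" if "f \<in> F" for f using h that by (auto simp: bij_betw_def)
  have "F \<noteq> {}" using Y.not_empty measurable_space[OF c(2)] by fastforce
  then have n: "0 < n" using c(1) by (simp add: n_def card_gt_0_iff)
  \<comment> \<open>There are at most \<open>m\<close> pairs of labels. Each costs the error
    \<open>\<delta>\<close> of weak containment plus the mass of \<open>D'\<close>, at most
    \<open>2 * (m * \<delta>)\<close>; together at most \<open>3 * m * \<delta>\<close> since
    \<open>m\<close> is at least 1. Summing over the pairs gives
    \<open>3 * m\<^sup>2 * \<delta>\<close>, which is \<epsilon>.\<close>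
  define m where "m = real n ^ 2"
  have m: "1 \<le> m" using n by (simp add: m_def)
  define \<delta> where "\<delta> = \<epsilon> / (3 * m\<^sup>2)"
  have \<delta>: "0 < \<delta>" using \<epsilon> m by (simp add: \<delta>_def)
  define A where "A i = {y \<in> space Y. c y = h i}" for i
  have A: "A i \<in> sets Y" for i unfolding A_def by (rule finite_valued_pred[OF c(2,1)])
  have As: "A i \<subseteq> space Y" for i by (auto simp: A_def)
  obtain B0 where B0: "\<And>i. i < n \<Longrightarrow> B0 i \<in> sets X"
    and close: "\<And>i j g. i < n \<Longrightarrow> j < n \<Longrightarrow> g \<in> insert \<one>\<^bsub>G\<^esub> K \<Longrightarrow>
      \<bar>measure Y (b g ` A i \<inter> A j) - measure X (a g ` B0 i \<inter> B0 j)\<bar> < \<delta>"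
  proof -
    have "(\<forall>i<n. A i \<in> sets Y) \<and> finite (insert \<one>\<^bsub>G\<^esub> K) \<and> insert \<one>\<^bsub>G\<^esub> K \<subseteq> carrier G \<and> 0 < \<delta>"
      using A K \<delta> by simp
    from wc[unfolded weakly_contains_def, rule_format, OF this] show thesis
      using that by blast
  qed
  define B where "B i = (if i < n then B0 i else {})" for i
  have B[measurable]: "B i \<in> sets X" for i using B0 by (simp add: B_def)
  have Bs: "B i \<subseteq> space X" for i using B sets.sets_into_space by blast
  have tX: "measure X (a k ` B i \<inter> B j) = measure X {x \<in> space X. x \<in> B i \<and> a k x \<in> B j}"
    if k: "k \<in> carrier G" for k i j
  proof -
    have "a k ` B i \<inter> B j = {x \<in> space X. a (inv\<^bsub>G\<^esub> k) x \<in> B i \<and> x \<in> B j}"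
      using X.act_image[OF k Bs] Bs by auto
    also have "measure X \<dots> = measure X {x \<in> space X. a (inv\<^bsub>G\<^esub> k) (a k x) \<in> B i \<and> a k x \<in> B j}"
    proof (rule X.act_pred(2)[OF k, symmetric])
      note [measurable] = X.act_measurable[OF X.inv_closed[OF k]]
      show "{x \<in> space X. a (inv\<^bsub>G\<^esub> k) x \<in> B i \<and> x \<in> B j} \<in> sets X" by measurable
    qed
    also have "{x \<in> space X. a (inv\<^bsub>G\<^esub> k) (a k x) \<in> B i \<and> a k x \<in> B j} = {x \<in> space X. x \<in> B i \<and> a k x \<in> B j}"
      using k by (auto simp: X.act_mult X.act_one)
    finally show ?thesis .
  qed
  have tY: "measure Y (b k ` A i \<inter> A j) = measure Y {y \<in> space Y. c y = h i \<and> c (b k y) = h j}"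
    if k: "k \<in> carrier G" for k i j
  proof -
    have "b k ` A i \<inter> A j = {y \<in> space Y. b (inv\<^bsub>G\<^esub> k) y \<in> A i \<and> y \<in> A j}"
      using Y.act_image[OF k As] As by auto
    also have "measure Y \<dots> = measure Y {y \<in> space Y. b (inv\<^bsub>G\<^esub> k) (b k y) \<in> A i \<and> b k y \<in> A j}"
    proof (rule Y.act_pred(2)[OF k, symmetric])
      note [measurable] = Y.act_measurable[OF X.inv_closed[OF k]] A
      show "{y \<in> space Y. b (inv\<^bsub>G\<^esub> k) y \<in> A i \<and> y \<in> A j} \<in> sets Y" by measurable
    qed
    also have "{y \<in> space Y. b (inv\<^bsub>G\<^esub> k) (b k y) \<in> A i \<and> b k y \<in> A j} = {y \<in> space Y. c y = h i \<and> c (b k y) = h j}"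
      using k by (auto simp: Y.act_mult Y.act_one Y.act_closed A_def)
    finally show ?thesis .
  qed
  define D where "D = (\<Union>(i, j)\<in>{(i, j) \<in> {..<n} \<times> {..<n}. i \<noteq> j}. B i \<inter> B j)"
  have fin: "finite {(i, j) \<in> {..<n} \<times> {..<n}. R i j}" and card_le: "card {(i, j) \<in> {..<n} \<times> {..<n}. R i j} \<le> m" for R
  proof -
    have sub: "{(i, j) \<in> {..<n} \<times> {..<n}. R i j} \<subseteq> {..<n} \<times> {..<n}" by auto
    then show "finite {(i, j) \<in> {..<n} \<times> {..<n}. R i j}" by (rule finite_subset) auto
    have "card {(i, j) \<in> {..<n} \<times> {..<n}. R i j} \<le> card ({..<n} \<times> {..<n})"
      using sub by (intro card_mono) auto
    then show "card {(i, j) \<in> {..<n} \<times> {..<n}. R i j} \<le> m"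
      unfolding m_def card_cartesian_product card_lessThan power2_eq_square
      using of_nat_mono[of _ "n * n", where 'a = real] by force
  qed
  have D[measurable]: "D \<in> sets X" unfolding D_def using fin by (intro sets.finite_UN) auto
  have Dm: "measure X D \<le> m * \<delta>"
  proof -
    have "measure X D \<le> (\<Sum>(i, j)\<in>{(i, j) \<in> {..<n} \<times> {..<n}. i \<noteq> j}. measure X (B i \<inter> B j))"
      unfolding D_def case_prod_unfold
      using fin by (intro X.finite_measure_subadditive_finite) (auto simp: case_prod_unfold)
    also have "\<dots> \<le> (\<Sum>(i, j)\<in>{(i, j) \<in> {..<n} \<times> {..<n}. i \<noteq> j}. \<delta>)"
    proof (rule sum_mono, clarsimp)
      fix i j assume ij: "i < n" "j < n" "i \<noteq> j"
      \<comment> \<open>At the identity, disjointness of \<open>A i\<close> and \<open>A j\<close>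
        forces the overlap of \<open>B i\<close> and \<open>B j\<close> below
        \<open>\<delta>\<close>.\<close>
      have "a \<one>\<^bsub>G\<^esub> ` B0 i = B i"
        using Bs[of i] ij X.act_one by (force simp: B_def image_iff)
      moreover have "b \<one>\<^bsub>G\<^esub> ` A i \<inter> A j = {}"
        using ij h_inj Y.act_one by (auto simp: A_def)
      ultimately show "measure X (B i \<inter> B j) \<le> \<delta>"
        using close[of i j "\<one>\<^bsub>G\<^esub>"] ij by (simp add: B_def)
    qed
    also have "\<dots> \<le> m * \<delta>"
      using card_le[of "(\<noteq>)"] \<delta> by (simp add: case_prod_unfold)
    finally show ?thesis .
  qed
  \<comment> \<open>The condition is void at \<open>n - 1\<close>, so the minimum exists and is
    below \<open>n\<close>; the index \<open>n - 1\<close> doubles as the default for points in none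
    of the sets. Off \<open>D\<close> an index whose set contains \<open>x\<close> is unique and
    equals \<open>\<tau> x\<close>.\<close>
  define \<tau> where "\<tau> x = (LEAST i. i < n - 1 \<longrightarrow> x \<in> B i)" for x
  have \<tau>m: "\<tau> \<in> measurable X (count_space UNIV)" unfolding \<tau>_def by measurable
  have \<tau>n: "\<tau> x < n" for x
  proof -
    have "\<tau> x \<le> n - 1" unfolding \<tau>_def by (rule Least_le) simp
    then show ?thesis using n by linarith
  qed
  have \<tau>B: "\<tau> x = i" if "i < n" "x \<in> B i" "x \<notin> D" for x i
  proof -
    have "\<tau> x \<le> i" unfolding \<tau>_def by (rule Least_le) (use that in simp)
    moreover have "\<tau> x < n - 1 \<longrightarrow> x \<in> B (\<tau> x)" unfolding \<tau>_def by (rule LeastI[of _ i]) (use that in simp)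
    ultimately show ?thesis using that \<tau>n[of x] by (auto simp: D_def) 
  qed
  define c' where "c' x = h (\<tau> x)" for x
  have c'm: "c' \<in> measurable X (count_space F)"
  proof -
    have "\<tau> \<in> measurable X (count_space {..<n})"
      using measurable_sets[OF \<tau>m] \<tau>n by (intro measurableI) auto
    then show ?thesis unfolding c'_def by (rule measurable_finite_comp) (simp add: hF)
  qed
  moreover have "measure X {x \<in> space X. c' (a k x) \<noteq> \<sigma> k (c' x)}
      \<le> measure Y {y \<in> space Y. c (b k y) \<noteq> \<sigma> k (c y)} + \<epsilon>" if k: "k \<in> K" for k
  proof -
    have kG: "k \<in> carrier G" using k K by blast
    note [measurable] = X.act_measurable[OF kG]
    have pairX: "(\<lambda>x. (c' x, c' (a k x))) \<in> measurable X (count_space (F \<times> F))"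
      using c(1) c'm measurable_compose[OF X.act_measurable[OF kG] c'm] by (intro measurable_finite_pair)
    have pairY: "(\<lambda>y. (c y, c (b k y))) \<in> measurable Y (count_space (F \<times> F))"
      using c measurable_compose[OF Y.act_measurable[OF kG] c(2)] by (intro measurable_finite_pair)
    have FF: "finite (F \<times> F)" using c by simp
    \<comment> \<open>Off \<open>D'\<close> neither \<open>x\<close> nor \<open>a k x\<close> lies
      in an overlap, so membership in \<open>B i\<close> and \<open>B j\<close> determines both
      labels.\<close>
    define D' where "D' = D \<union> {x \<in> space X. a k x \<in> D}"
    have D'[measurable]: "D' \<in> sets X" unfolding D'_def by measurable
    have D'm: "measure X D' \<le> 2 * (m * \<delta>)"
    proof -
      have "{x \<in> space X. x \<in> D} = D" using sets.sets_into_space[OF D] by auto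
      then have "measure X {x \<in> space X. a k x \<in> D} = measure X D"
        using X.act_pred(2)[OF kG, of "\<lambda>x. x \<in> D"] D by simp
      moreover have "measure X D' \<le> measure X D + measure X {x \<in> space X. a k x \<in> D}"
        unfolding D'_def by (intro measure_Un_le) measurable
      ultimately show ?thesis using Dm by simp
    qed
    define P where "P = {(i, j) \<in> {..<n} \<times> {..<n}. h j = \<sigma> k (h i)}"
    define U where "U = (\<lambda>(i, j). {x \<in> space X. x \<in> B i \<and> a k x \<in> B j})"
    have P: "finite P" "card P \<le> m" unfolding P_def using fin card_le by auto
    have U[measurable]: "U p \<in> sets X" for p unfolding U_def case_prod_unfold by measurable
    have "measure Y {y \<in> space Y. c (b k y) = \<sigma> k (c y)}
        = (\<Sum>p\<in>P. measure Y {y \<in> space Y. c y = h (fst p) \<and> c (b k y) = h (snd p)})"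
    proof -
      have "{y \<in> space Y. c (b k y) = \<sigma> k (c y)}
          = (\<Union>p\<in>P. {y \<in> space Y. c y = h (fst p) \<and> c (b k y) = h (snd p)})"
      proof (intro equalityI subsetI)
        fix y assume y: "y \<in> {y \<in> space Y. c (b k y) = \<sigma> k (c y)}"
        then obtain i j where ij: "i < n" "c y = h i" "j < n" "c (b k y) = h j"
          using h_surj measurable_space[OF c(2)] Y.act_closed[OF kG] by (metis (mono_tags, lifting) mem_Collect_eq space_count_space)
        then show "y \<in> (\<Union>p\<in>P. {y \<in> space Y. c y = h (fst p) \<and> c (b k y) = h (snd p)})"
          using y ij by (intro UN_I[of "(i, j)"]) (auto simp: P_def)
      qed (auto simp: P_def)
      also have "measure Y \<dots> = (\<Sum>p\<in>P. measure Y {y \<in> space Y. c y = h (fst p) \<and> c (b k y) = h (snd p)})"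
      proof (rule Y.finite_measure_finite_Union[OF P(1)])
        have "{y \<in> space Y. c y = h (fst p) \<and> c (b k y) = h (snd p)} \<in> sets Y" for p
          using finite_valued_pred[OF pairY FF, of "\<lambda>r. fst r = h (fst p) \<and> snd r = h (snd p)"] by simp
        then show "(\<lambda>p. {y \<in> space Y. c y = h (fst p) \<and> c (b k y) = h (snd p)}) ` P \<subseteq> sets Y" by blast
        show "disjoint_family_on (\<lambda>p. {y \<in> space Y. c y = h (fst p) \<and> c (b k y) = h (snd p)}) P"
        proof -
          have "p = r" if "p \<in> P" "r \<in> P" "c y = h (fst p)" "c (b k y) = h (snd p)"
            "c y = h (fst r)" "c (b k y) = h (snd r)" for p r y
          proof (rule prod_eqI)
            have "fst p < n" "snd p < n" "fst r < n" "snd r < n" using that(1,2) by (auto simp: P_def)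
            moreover have "h (fst p) = h (fst r)" "h (snd p) = h (snd r)" using that(3-6) by metis+
            ultimately show "fst p = fst r" "snd p = snd r" using h_inj by metis+
          qed
          then show ?thesis unfolding disjoint_family_on_def by blast
        qed
      qed
      finally show ?thesis .
    qed
    also have "\<dots> \<le> (\<Sum>p\<in>P. measure X (U p - D') + (\<delta> + 2 * (m * \<delta>)))"
    proof (rule sum_mono)
      fix p assume "p \<in> P"
      then obtain i j where p: "p = (i, j)" "i < n" "j < n" by (auto simp: P_def)
      have "measure Y {y \<in> space Y. c y = h i \<and> c (b k y) = h j} \<le> measure X (U p) + \<delta>"
        using close[of i j k] tX[OF kG, of i j] tY[OF kG, of i j] p k by (simp add: B_def U_def)
      moreover have "measure X (U p) \<le> measure X ((U p - D') \<union> D')"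
        by (intro X.finite_measure_mono) auto
      moreover have "measure X ((U p - D') \<union> D') \<le> measure X (U p - D') + measure X D'"
        by (intro measure_Un_le) auto
      ultimately show "measure Y {y \<in> space Y. c y = h (fst p) \<and> c (b k y) = h (snd p)}
          \<le> measure X (U p - D') + (\<delta> + 2 * (m * \<delta>))"
        using D'm p by simp
    qed
    also have "\<dots> = (\<Sum>p\<in>P. measure X (U p - D')) + card P * (\<delta> + 2 * (m * \<delta>))"
      by (simp add: sum.distrib)
    also have "\<dots> \<le> measure X {x \<in> space X. c' (a k x) = \<sigma> k (c' x)} + \<epsilon>"
    proof (rule add_mono)
      have "(\<Sum>p\<in>P. measure X (U p - D')) = measure X (\<Union>p\<in>P. U p - D')"
      proof (rule X.finite_measure_finite_Union[OF P(1), symmetric])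
        have "(p = r)" if "p \<in> P" "r \<in> P" "x \<in> U p - D'" "x \<in> U r - D'" for p r x
          using that \<tau>B by (auto simp: P_def U_def D'_def)
        then show "disjoint_family_on (\<lambda>p. U p - D') P" unfolding disjoint_family_on_def by blast
      qed auto
      also have "\<dots> \<le> measure X {x \<in> space X. c' (a k x) = \<sigma> k (c' x)}"
      proof (rule X.finite_measure_mono)
        show "(\<Union>p\<in>P. U p - D') \<subseteq> {x \<in> space X. c' (a k x) = \<sigma> k (c' x)}"
          using \<tau>B by (auto simp: P_def U_def D'_def c'_def)
        show "{x \<in> space X. c' (a k x) = \<sigma> k (c' x)} \<in> sets X"
          using finite_valued_pred[OF pairX FF, of "\<lambda>p. snd p = \<sigma> k (fst p)"] by simp
      qed
      finally show "(\<Sum>p\<in>P. measure X (U p - D')) \<le> measure X {x \<in> space X. c' (a k x) = \<sigma> k (c' x)}" .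
      have "card P * (\<delta> + 2 * (m * \<delta>)) \<le> m * (3 * m * \<delta>)"
      proof (rule mult_mono)
        show "\<delta> + 2 * (m * \<delta>) \<le> 3 * m * \<delta>" using m \<delta> by simp
      qed (use P m \<delta> in auto)
      also have "\<dots> = \<epsilon>" using m by (simp add: \<delta>_def power2_eq_square)
      finally show "card P * (\<delta> + 2 * (m * \<delta>)) \<le> \<epsilon>" .
    qed
    finally have main: "measure Y {y \<in> space Y. c (b k y) = \<sigma> k (c y)}
      \<le> measure X {x \<in> space X. c' (a k x) = \<sigma> k (c' x)} + \<epsilon>" .
    have "measure Y {y \<in> space Y. c (b k y) \<noteq> \<sigma> k (c y)} = 1 - measure Y {y \<in> space Y. c (b k y) = \<sigma> k (c y)}"
      using Y.prob_neg[of "\<lambda>y. c (b k y) = \<sigma> k (c y)"]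
        finite_valued_pred[OF pairY FF, of "\<lambda>p. snd p = \<sigma> k (fst p)"] by simp
    moreover have "measure X {x \<in> space X. c' (a k x) \<noteq> \<sigma> k (c' x)} = 1 - measure X {x \<in> space X. c' (a k x) = \<sigma> k (c' x)}"
      using X.prob_neg[of "\<lambda>x. c' (a k x) = \<sigma> k (c' x)"]
        finite_valued_pred[OF pairX FF, of "\<lambda>p. snd p = \<sigma> k (fst p)"] by simp
    ultimately show ?thesis using main by linarith
  qed
  ultimately show thesis by (rule that)
qed

section \<open>Reduction to the kernel\<close>

lemma factor_map_refl: "pmp_action G X a \<Longrightarrow> factor_map G X a X a (\<lambda>x. x)"
  by (simp add: factor_map_def distr_id)

lemma factor_map_pred:
  assumes "factor_map G Z b X a f" "{x \<in> space X. P x} \<in> sets X"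
  shows "{z \<in> space Z. P (f z)} \<in> sets Z"
    and "measure Z {z \<in> space Z. P (f z)} = measure X {x \<in> space X. P x}"
proof -
  have f: "f \<in> measurable Z X" and d: "distr Z X f = X" using assms(1) by (auto simp: factor_map_def)
  have e: "{z \<in> space Z. P (f z)} = f -` {x \<in> space X. P x} \<inter> space Z"
    using measurable_space[OF f] by auto
  show "{z \<in> space Z. P (f z)} \<in> sets Z" unfolding e by (rule measurable_sets[OF f assms(2)])
  have "measure X {x \<in> space X. P x} = measure (distr Z X f) {x \<in> space X. P x}" by (simp add: d)
  also have "\<dots> = measure Z {z \<in> space Z. P (f z)}"
    unfolding e by (rule measure_distr[OF f assms(2)])
  finally show "measure Z {z \<in> space Z. P (f z)} = measure X {x \<in> space X. P x}" by simp
qed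

section \<open>Statistics along towers over the quotient\<close>

locale tower = q: group_hom G Q q
  for G (structure) and Q (structure) and q :: "'g \<Rightarrow> 'q" +
  fixes r :: "'q \<Rightarrow> 'g" and F :: "'q set" and S :: "'g set"
  assumes F: "finite F" "F \<subseteq> carrier Q" and S: "finite S" "S \<subseteq> carrier G"
    and r: "\<And>f. f \<in> F \<Longrightarrow> r f \<in> carrier G" "\<And>f. f \<in> F \<Longrightarrow> q (r f) = f"
begin

text \<open>From a base point z, the point x = \<open>r f\<close> z in slot \<open>f\<close> is
  reached by \<open>r f\<close>, and s^-1 x by an element of the second kind. At these places the
  labels of the factor are read.\<close>

definition shifts :: "'g set" where
  "shifts = r ` F \<union> (\<lambda>(s, f). inv\<^bsub>G\<^esub> s \<otimes>\<^bsub>G\<^esub> r f) ` (S \<times> F)"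

text \<open>If x = \<open>r f\<close> z and s^-1 x carries the label \<open>h\<close>, then
  \<open>jump s f h\<close> takes z to the base point of s^-1 x.\<close>

definition jump :: "'g \<Rightarrow> 'q \<Rightarrow> 'q \<Rightarrow> 'g" where
  "jump s f h = inv\<^bsub>G\<^esub> (r h) \<otimes>\<^bsub>G\<^esub> (inv\<^bsub>G\<^esub> s \<otimes>\<^bsub>G\<^esub> r f)"

text \<open>Only jumps in the kernel are kept, since a labelling of the extension can be copied only
  along the kernel. Inverses appear because \<open>translates\<close> evaluates at the inverse of
  its index.\<close>

definition returns :: "'g set" where
  "returns = (\<lambda>(s, f, h). inv\<^bsub>G\<^esub> (jump s f h)) ` {(s, f, h) \<in> S \<times> F \<times> F. q (jump s f h) = \<one>\<^bsub>Q\<^esub>}"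

text \<open>The event, at a base point z, that x = \<open>r f\<close> z has label \<open>f\<close>
  and \<beta>-value \<open>j\<close>, that the labels are equivariant from x to each s^-1 x (each
  jump is in the kernel, see \<open>jump_kernel_iff\<close>), and that the \<alpha>-values there are
  \<open>\<pi>\<close>. The tuple \<open>\<omega>\<close> holds the labels at kernel translates of
  z, and \<open>v\<close> those of the factor at all \<open>shifts\<close>; the joint law of these
  two tuples is what the approximation controls.\<close>

definition pattern :: "('g \<Rightarrow> nat) \<Rightarrow> nat \<Rightarrow> 'q \<Rightarrow> ('g \<Rightarrow> 'q \<Rightarrow> nat) \<Rightarrow> ('g \<Rightarrow> 'q \<times> nat) \<Rightarrow> bool" where
  "pattern \<pi> j f \<omega> v \<longleftrightarrow> fst (v (r f)) = f \<and> snd (v (r f)) = j \<and>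
     (\<forall>s\<in>S. q (jump s f (fst (v (inv\<^bsub>G\<^esub> s \<otimes>\<^bsub>G\<^esub> r f)))) = \<one>\<^bsub>Q\<^esub> \<and>
        \<omega> (inv\<^bsub>G\<^esub> (jump s f (fst (v (inv\<^bsub>G\<^esub> s \<otimes>\<^bsub>G\<^esub> r f))))) (fst (v (inv\<^bsub>G\<^esub> s \<otimes>\<^bsub>G\<^esub> r f))) = \<pi> s)"

lemma shifts: "finite shifts" "shifts \<subseteq> carrier G"
  using F S r by (auto simp: shifts_def)

lemma jump_closed: "s \<in> S \<Longrightarrow> f \<in> F \<Longrightarrow> h \<in> F \<Longrightarrow> jump s f h \<in> carrier G"
  using S r by (auto simp: jump_def)

lemma returns: "finite returns" "returns \<subseteq> {g \<in> carrier G. q g = \<one>\<^bsub>Q\<^esub>}"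
proof -
  have "{(s, f, h) \<in> S \<times> F \<times> F. q (jump s f h) = \<one>\<^bsub>Q\<^esub>} \<subseteq> S \<times> F \<times> F" by auto
  then show "finite returns"
    unfolding returns_def using F S by (intro finite_imageI) (auto intro: finite_subset)
  show "returns \<subseteq> {g \<in> carrier G. q g = \<one>\<^bsub>Q\<^esub>}"
    by (auto simp: returns_def jump_closed)
qed

lemma jump_kernel_iff:
  assumes "s \<in> S" "f \<in> F" "h \<in> F"
  shows "q (jump s f h) = \<one>\<^bsub>Q\<^esub> \<longleftrightarrow> h = q (inv\<^bsub>G\<^esub> s) \<otimes>\<^bsub>Q\<^esub> f"
proof -
  have c: "s \<in> carrier G" "f \<in> carrier Q" "h \<in> carrier Q" using assms S F by auto
  have "q (jump s f h) = inv\<^bsub>Q\<^esub> h \<otimes>\<^bsub>Q\<^esub> (q (inv\<^bsub>G\<^esub> s) \<otimes>\<^bsub>Q\<^esub> f)"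
    using assms c by (simp add: jump_def r)
  also have "\<dots> = \<one>\<^bsub>Q\<^esub> \<longleftrightarrow> h = q (inv\<^bsub>G\<^esub> s) \<otimes>\<^bsub>Q\<^esub> f"
  proof
    assume "inv\<^bsub>Q\<^esub> h \<otimes>\<^bsub>Q\<^esub> (q (inv\<^bsub>G\<^esub> s) \<otimes>\<^bsub>Q\<^esub> f) = \<one>\<^bsub>Q\<^esub>"
    then have "h \<otimes>\<^bsub>Q\<^esub> (inv\<^bsub>Q\<^esub> h \<otimes>\<^bsub>Q\<^esub> (q (inv\<^bsub>G\<^esub> s) \<otimes>\<^bsub>Q\<^esub> f)) = h" using c by simp
    then show "h = q (inv\<^bsub>G\<^esub> s) \<otimes>\<^bsub>Q\<^esub> f" using c by (simp add: q.H.m_assoc[symmetric])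
  qed (use c in simp)
  finally show ?thesis .
qed

text \<open>The statistics of \<open>\<alpha>\<close> over \<open>S\<close> are read off at the bases of the towers, where only the
  kernel of \<open>q\<close> acts. The lemma is applied to the extension and, with \<open>f\<close> the identity,
  to the factor itself.\<close>

lemma statistics_at_base:
  fixes f :: "'z \<Rightarrow> 'x" and e :: real
  assumes fm: "factor_map G Z b X a f"
    and c: "c \<in> measurable X (count_space F)" and \<beta>: "\<beta> \<in> measurable X (count_space {..<m})"
    and \<alpha>: "\<alpha> \<in> measurable Z (count_space {..<p})"
    and w: "finite W" "w \<in> measurable Z (count_space W)"
    and link: "\<And>z. z \<in> space Z \<Longrightarrow> \<alpha> z = w (b (inv\<^bsub>G\<^esub> (r (c (f z)))) z) (c (f z))"
    and e: "\<And>s. s \<in> S \<Longrightarrow> measure X {x \<in> space X. c (a (inv\<^bsub>G\<^esub> s) x) \<noteq> q (inv\<^bsub>G\<^esub> s) \<otimes>\<^bsub>Q\<^esub> c x} \<le> e"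
  shows "\<bar>measure Z {z \<in> space Z. (\<forall>s\<in>S. \<alpha> (b (inv\<^bsub>G\<^esub> s) z) = \<pi> s) \<and> \<beta> (f z) = j}
    - (\<Sum>h\<in>F. measure Z {z \<in> space Z. pattern \<pi> j h (\<lambda>l\<in>returns. w (b (inv\<^bsub>G\<^esub> l) z))
        (\<lambda>g\<in>shifts. (c (a g (f z)), \<beta> (a g (f z))))})\<bar> \<le> card S * e"
proof -
  interpret Z: pmp_system G Z b using fm by unfold_locales (simp add: factor_map_def)
  interpret X: pmp_system G X a using fm by unfold_locales (simp add: factor_map_def)
  have f: "f \<in> measurable Z X" using fm by (simp add: factor_map_def)
  have equi: "AE z in Z. f (b g z) = a g (f z)" if "g \<in> carrier G" for g
    using fm that by (simp add: factor_map_def)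
  have SG: "inv\<^bsub>G\<^esub> s \<in> carrier G" if "s \<in> S" for s using S that by auto
  have cF: "c x \<in> F" if "x \<in> space X" for x using measurable_space[OF c that] by simp
  define Good where "Good x \<longleftrightarrow> (\<forall>s\<in>S. c (a (inv\<^bsub>G\<^esub> s) x) = q (inv\<^bsub>G\<^esub> s) \<otimes>\<^bsub>Q\<^esub> c x)" for x
  define T where "T z \<longleftrightarrow> (\<forall>s\<in>S. \<alpha> (b (inv\<^bsub>G\<^esub> s) z) = \<pi> s) \<and> \<beta> (f z) = j" for z
  define E where "E h z \<longleftrightarrow> c (f z) = h \<and> Good (f z) \<and> T z" for h z
  define R where "R h z \<longleftrightarrow> pattern \<pi> j h (\<lambda>l\<in>returns. w (b (inv\<^bsub>G\<^esub> l) z))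
        (\<lambda>g\<in>shifts. (c (a g (f z)), \<beta> (a g (f z))))" for h z
  have bad_set: "{x \<in> space X. c (a (inv\<^bsub>G\<^esub> s) x) \<noteq> q (inv\<^bsub>G\<^esub> s) \<otimes>\<^bsub>Q\<^esub> c x} \<in> sets X" if s: "s \<in> S" for s
  proof -
    have "(\<lambda>x. (c x, c (a (inv\<^bsub>G\<^esub> s) x))) \<in> measurable X (count_space (F \<times> F))"
      using F c measurable_compose[OF X.act_measurable[OF SG[OF s]] c] by (intro measurable_finite_pair)
    from finite_valued_pred[OF this, of "\<lambda>p. snd p \<noteq> q (inv\<^bsub>G\<^esub> s) \<otimes>\<^bsub>Q\<^esub> fst p"] F show ?thesis by simp
  qed
  have good_set: "{x \<in> space X. Good x} \<in> sets X"
  proof -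
    have "{x \<in> space X. Good x} = space X - (\<Union>s\<in>S. {x \<in> space X. c (a (inv\<^bsub>G\<^esub> s) x) \<noteq> q (inv\<^bsub>G\<^esub> s) \<otimes>\<^bsub>Q\<^esub> c x})"
      by (auto simp: Good_def)
    then show ?thesis using S bad_set by (auto intro!: sets.Diff sets.finite_UN)
  qed
  have good_set': "{z \<in> space Z. Good (f z)} \<in> sets Z" by (rule factor_map_pred(1)[OF fm good_set])
  have c_set: "{z \<in> space Z. c (f z) = h} \<in> sets Z" for h
    by (rule factor_map_pred(1)[OF fm]) (rule finite_valued_pred[OF c F(1)])
  have T_set: "{z \<in> space Z. T z} \<in> sets Z"
  proof -
    have "{z \<in> space Z. \<alpha> (b (inv\<^bsub>G\<^esub> s) z) = \<pi> s} \<in> sets Z" if s: "s \<in> S" for s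
      by (rule finite_valued_pred[OF measurable_compose[OF Z.act_measurable[OF SG[OF s]] \<alpha>]]) simp
    moreover have "{z \<in> space Z. \<beta> (f z) = j} \<in> sets Z"
      by (rule factor_map_pred(1)[OF fm]) (rule finite_valued_pred[OF \<beta>], simp)
    ultimately show ?thesis
      unfolding T_def using S by (intro sets.sets_Collect_conj sets.sets_Collect_finite_All)
  qed
  have E_set: "{z \<in> space Z. E h z} \<in> sets Z" for h
    unfolding E_def using c_set good_set' T_set by (intro sets.sets_Collect_conj)
  have R_set: "{z \<in> space Z. R h z} \<in> sets Z" for h
  proof -
    have "inv\<^bsub>G\<^esub> l \<in> carrier G" if "l \<in> returns" for l using returns that by auto
    moreover have "g \<in> carrier G" if "g \<in> shifts" for g using shifts that by auto
    ultimately have "(\<lambda>z. (\<lambda>l\<in>returns. w (b (inv\<^bsub>G\<^esub> l) z), \<lambda>g\<in>shifts. (c (a g (f z)), \<beta> (a g (f z)))))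
        \<in> measurable Z (count_space ((returns \<rightarrow>\<^sub>E W) \<times> (shifts \<rightarrow>\<^sub>E F \<times> {..<m})))"
      using returns(1) shifts(1) w c \<beta> F f
      by (intro measurable_finite_pair measurable_finite_tuple
        measurable_compose[OF Z.act_measurable] measurable_compose[OF f]
        measurable_compose[OF X.act_measurable]) (auto intro: finite_PiE)
    from finite_valued_pred[OF this, of "\<lambda>d. pattern \<pi> j h (fst d) (snd d)"] returns(1) shifts(1) w(1) F(1)
    show ?thesis by (simp add: R_def finite_PiE)
  qed
  \<comment> \<open>\<open>R h\<close> is \<open>E h\<close> seen from the base: for almost every z,
    \<open>R h z\<close> holds exactly when \<open>E h\<close> holds at \<open>b (r h) z\<close>.
    The exceptional null set arises because \<open>f\<close> is equivariant only almost everywhere.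
    Invariance under \<open>r h\<close> then equates the measures.\<close>
  have RE: "measure Z {z \<in> space Z. R h z} = measure Z {z \<in> space Z. E h z}" if h: "h \<in> F" for h
  proof -
    have rh: "r h \<in> carrier G" using r h by simp
    have "AE z in Z. \<forall>s\<in>S. f (b (inv\<^bsub>G\<^esub> s \<otimes>\<^bsub>G\<^esub> r h) z) = a (inv\<^bsub>G\<^esub> s \<otimes>\<^bsub>G\<^esub> r h) (f z)"
      using S rh SG by (intro AE_finite_allI equi) auto
    moreover have "AE z in Z. f (b (r h) z) = a (r h) (f z)" using rh by (rule equi)
    moreover have "AE z in Z. z \<in> space Z" by simp
    ultimately have "AE z in Z. R h z \<longleftrightarrow> E h (b (r h) z)"
    proof (eventually_elim, goal_cases)
      case (1 z)
      define y where "y = b (r h) z"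
      define k where "k s = c (a (inv\<^bsub>G\<^esub> s) (f y))" for s
      have z: "z \<in> space Z" "f z \<in> space X" and y: "y \<in> space Z" "f y = a (r h) (f z)"
        using 1 rh measurable_space[OF f] by (auto simp: y_def Z.act_closed)
      have fy: "f y \<in> space X" using y(1) by (rule measurable_space[OF f])
      have rs: "r h \<in> shifts" "\<And>s. s \<in> S \<Longrightarrow> inv\<^bsub>G\<^esub> s \<otimes>\<^bsub>G\<^esub> r h \<in> shifts"
        using h by (auto simp: shifts_def)
      have ax: "a (inv\<^bsub>G\<^esub> s \<otimes>\<^bsub>G\<^esub> r h) (f z) = a (inv\<^bsub>G\<^esub> s) (f y)" if "s \<in> S" for s
        using z rh SG[OF that] by (simp add: y(2) X.act_mult)
      have kF: "k s \<in> F" if "s \<in> S" for s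
        using cF X.act_closed[OF SG[OF that] fy] by (simp add: k_def)
      have step: "(\<lambda>l\<in>returns. w (b (inv\<^bsub>G\<^esub> l) z)) (inv\<^bsub>G\<^esub> (jump s h (k s))) (k s) = \<alpha> (b (inv\<^bsub>G\<^esub> s) y)"
        if s: "s \<in> S" and one: "q (jump s h (k s)) = \<one>\<^bsub>Q\<^esub>" for s
      proof -
        have J: "jump s h (k s) \<in> carrier G" using jump_closed s h kF by blast
        have "(s, h, k s) \<in> {(s, f, h) \<in> S \<times> F \<times> F. q (jump s f h) = \<one>\<^bsub>Q\<^esub>}"
          using s h kF one by simp
        then have "inv\<^bsub>G\<^esub> (jump s h (k s)) \<in> returns" unfolding returns_def by (rule rev_image_eqI) simp
        then have "(\<lambda>l\<in>returns. w (b (inv\<^bsub>G\<^esub> l) z)) (inv\<^bsub>G\<^esub> (jump s h (k s))) (k s) = w (b (jump s h (k s)) z) (k s)"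
          using J by simp
        also have "b (jump s h (k s)) z = b (inv\<^bsub>G\<^esub> (r (k s))) (b (inv\<^bsub>G\<^esub> s \<otimes>\<^bsub>G\<^esub> r h) z)"
          unfolding jump_def using z rh SG[OF s] kF[OF s] r by (simp add: Z.act_mult)
        also have "b (inv\<^bsub>G\<^esub> s \<otimes>\<^bsub>G\<^esub> r h) z = b (inv\<^bsub>G\<^esub> s) y"
          unfolding y_def using z rh SG[OF s] by (simp add: Z.act_mult)
        \<comment> \<open>This is \<open>link\<close> at the point s^-1 y: its label is
          \<open>k s\<close>, so its \<alpha>-value is the entry \<open>k s\<close> at its
          base.\<close>
        also have "w (b (inv\<^bsub>G\<^esub> (r (k s))) (b (inv\<^bsub>G\<^esub> s) y)) (k s) = \<alpha> (b (inv\<^bsub>G\<^esub> s) y)"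
        proof -
          have "f (b (inv\<^bsub>G\<^esub> s) y) = a (inv\<^bsub>G\<^esub> s) (f y)"
            using 1(1) s ax[OF s] z rh SG[OF s] unfolding y_def by (simp add: Z.act_mult)
          then have "c (f (b (inv\<^bsub>G\<^esub> s) y)) = k s" by (simp add: k_def)
          then show ?thesis using link[OF Z.act_closed[OF SG[OF s] y(1)]] by simp
        qed
        finally show ?thesis .
      qed
      have "R h z \<longleftrightarrow> c (f y) = h \<and> \<beta> (f y) = j \<and> (\<forall>s\<in>S. q (jump s h (k s)) = \<one>\<^bsub>Q\<^esub> \<and>
          (\<lambda>l\<in>returns. w (b (inv\<^bsub>G\<^esub> l) z)) (inv\<^bsub>G\<^esub> (jump s h (k s))) (k s) = \<pi> s)"
        unfolding R_def pattern_def k_def using rs by (simp add: ax y(2) cong: ball_cong)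
      also have "\<dots> \<longleftrightarrow> c (f y) = h \<and> \<beta> (f y) = j \<and> (\<forall>s\<in>S. k s = q (inv\<^bsub>G\<^esub> s) \<otimes>\<^bsub>Q\<^esub> h \<and> \<alpha> (b (inv\<^bsub>G\<^esub> s) y) = \<pi> s)"
        using step jump_kernel_iff[OF _ h kF] by metis
      also have "\<dots> \<longleftrightarrow> E h y" by (auto simp: E_def Good_def T_def k_def)
      finally show ?case by (simp add: y_def)
    qed
    then have "measure Z {z \<in> space Z. R h z} = measure Z {z \<in> space Z. E h (b (r h) z)}"
      using R_set Z.act_pred(1)[OF rh E_set] by (intro Z.finite_measure_eq_AE) auto
    then show ?thesis using Z.act_pred(2)[OF rh E_set] by simp
  qed
  have "(\<Sum>h\<in>F. measure Z {z \<in> space Z. E h z}) = measure Z {z \<in> space Z. Good (f z) \<and> T z}"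
  proof -
    have "(\<Sum>h\<in>F. measure Z {z \<in> space Z. E h z}) = measure Z (\<Union>h\<in>F. {z \<in> space Z. E h z})"
      using F E_set
      by (intro Z.finite_measure_finite_Union[symmetric]) (auto simp: disjoint_family_on_def E_def)
    also have "(\<Union>h\<in>F. {z \<in> space Z. E h z}) = {z \<in> space Z. Good (f z) \<and> T z}"
      using cF measurable_space[OF f] by (auto simp: E_def)
    finally show ?thesis .
  qed
  moreover have "measure Z {z \<in> space Z. Good (f z) \<and> T z} \<le> measure Z {z \<in> space Z. T z}"
    using T_set by (intro Z.finite_measure_mono) auto
  \<comment> \<open>The events \<open>E h\<close> miss only the part of \<open>T\<close> where
    equivariance of \<open>c\<close> fails for some element of \<open>S\<close>.\<close>
  moreover have "measure Z {z \<in> space Z. T z} \<le> measure Z {z \<in> space Z. Good (f z) \<and> T z} + card S * e"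
  proof -
    have GT: "{z \<in> space Z. Good (f z) \<and> T z} \<in> sets Z"
      using good_set' T_set by (intro sets.sets_Collect_conj)
    let ?N = "\<lambda>s. {z \<in> space Z. c (a (inv\<^bsub>G\<^esub> s) (f z)) \<noteq> q (inv\<^bsub>G\<^esub> s) \<otimes>\<^bsub>Q\<^esub> c (f z)}"
    have N: "?N s \<in> sets Z" "measure Z (?N s) \<le> e" if "s \<in> S" for s
      using factor_map_pred[OF fm bad_set[OF that]] e[OF that] by auto
    have "measure Z {z \<in> space Z. T z} \<le> measure Z ({z \<in> space Z. Good (f z) \<and> T z} \<union> (\<Union>s\<in>S. ?N s))"
      using GT N S by (intro Z.finite_measure_mono sets.Un sets.finite_UN) (auto simp: Good_def)
    also have "\<dots> \<le> measure Z {z \<in> space Z. Good (f z) \<and> T z} + measure Z (\<Union>s\<in>S. ?N s)"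
      using GT N S by (intro measure_Un_le sets.finite_UN) auto
    also have "measure Z (\<Union>s\<in>S. ?N s) \<le> (\<Sum>s\<in>S. measure Z (?N s))"
      using N S by (intro Z.finite_measure_subadditive_finite) auto
    also have "\<dots> \<le> (\<Sum>s\<in>S. e)" using N by (intro sum_mono)
    finally show ?thesis by simp
  qed
  ultimately have "\<bar>measure Z {z \<in> space Z. T z} - (\<Sum>h\<in>F. measure Z {z \<in> space Z. R h z})\<bar> \<le> card S * e"
    using RE by simp
  then show ?thesis by (simp only: T_def R_def)
qed

end

text \<open>The statistics of \<open>\<alpha>\<close> on \<open>Z\<close> and of
  \<open>\<alpha>'\<close> on \<open>X\<close> are each within \<open>card S * e\<close> of a sum of
  pattern events at the bases, by the same lemma. Those events involve only kernel translates of
  \<open>w\<close> or \<open>w'\<close> and one finite label of the factor, so closedness over the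
  kernel matches them.\<close>

lemma ec_factor_map_extend:
  fixes f :: "'z \<Rightarrow> 'x" and q :: "'g \<Rightarrow> 'q"
  assumes hom: "group_hom G Q q" and surj: "q ` carrier G = carrier Q"
    and ker: "\<Lambda> = {g \<in> carrier G. q g = \<one>\<^bsub>Q\<^esub>}"
    and fm: "factor_map G Z b X a f" and ec: "ec_factor_map (G\<lparr>carrier := \<Lambda>\<rparr>) Z b X a f"
    and maps: "\<And>K \<epsilon>. finite K \<Longrightarrow> K \<subseteq> carrier G \<Longrightarrow> 0 < (\<epsilon> :: real) \<Longrightarrow>
      \<exists>F c. finite F \<and> F \<subseteq> carrier Q \<and> c \<in> measurable X (count_space F) \<and>
        (\<forall>k\<in>K. measure X {x \<in> space X. c (a k x) \<noteq> q k \<otimes>\<^bsub>Q\<^esub> c x} \<le> \<epsilon>)"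
  shows "ec_factor_map G Z b X a f"
  unfolding ec_factor_map_def
proof (intro conjI fm allI ballI impI)
  interpret q: group_hom G Q q by (rule hom)
  interpret Z: pmp_system G Z b using fm by unfold_locales (simp add: factor_map_def)
  interpret X: pmp_system G X a using fm by unfold_locales (simp add: factor_map_def)
  have f: "f \<in> measurable Z X" using fm by (simp add: factor_map_def)
  fix p m :: nat and \<alpha> \<beta> S and \<epsilon> :: real
  assume \<alpha>: "\<alpha> \<in> measurable Z (count_space {..<p})" and \<beta>: "\<beta> \<in> measurable X (count_space {..<m})"
    and "finite S \<and> S \<subseteq> carrier G \<and> 0 < \<epsilon>"
  then have S: "finite S" "S \<subseteq> carrier G" and \<epsilon>: "0 < \<epsilon>" by auto
  \<comment> \<open>Each of the two reductions to the bases will cost less than \<epsilon>/4; the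
    later choice of \<open>\<delta>\<close> makes the comparison of the two sums cost less than
    \<epsilon>/2.\<close>
  define e where "e = \<epsilon> / (4 * (real (card S) + 1))"
  have e: "0 < e" using \<epsilon> by (simp add: e_def)
  obtain F c where F: "finite F" "F \<subseteq> carrier Q" and c: "c \<in> measurable X (count_space F)"
    and ce: "\<And>k. k \<in> (\<lambda>s. inv\<^bsub>G\<^esub> s) ` S \<Longrightarrow> measure X {x \<in> space X. c (a k x) \<noteq> q k \<otimes>\<^bsub>Q\<^esub> c x} \<le> e"
  proof -
    have "finite ((\<lambda>s. inv\<^bsub>G\<^esub> s) ` S)" "(\<lambda>s. inv\<^bsub>G\<^esub> s) ` S \<subseteq> carrier G" using S by auto
    from maps[OF this e] show thesis using that by blast
  qed
  define r where "r = inv_into (carrier G) q"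
  have r: "r h \<in> carrier G" "q (r h) = h" if "h \<in> F" for h
    using that F surj by (auto simp: r_def subset_eq intro!: inv_into_into f_inv_into_f)
  interpret tower G Q q r F S by unfold_locales (use F S r in auto)
  have cF: "c x \<in> F" if "x \<in> space X" for x using measurable_space[OF c that] by simp
  define W where "W = F \<rightarrow>\<^sub>E {..<p}"
  define V where "V = shifts \<rightarrow>\<^sub>E F \<times> {..<m}"
  \<comment> \<open>A base point carries the \<alpha>-values of its entire tile, so the value at a
    point can be recovered at its base. The labels of the factor at all \<open>shifts\<close> go
    into \<open>v\<close>, which plays the role of \<open>\<beta>\<close> for the kernel.\<close>
  define w where "w z = (\<lambda>h\<in>F. \<alpha> (b (r h) z))" for z
  define v where "v x = (\<lambda>g\<in>shifts. (c (a g x), \<beta> (a g x)))" for x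
  have W: "finite W" using F by (auto simp: W_def intro: finite_PiE)
  have V: "finite V" using F shifts by (auto simp: V_def intro: finite_PiE)
  have wm: "w \<in> measurable Z (count_space W)"
    unfolding w_def W_def using F r \<alpha>
    by (intro measurable_finite_tuple measurable_compose[OF Z.act_measurable]) auto
  have vm: "v \<in> measurable X (count_space V)"
    unfolding v_def V_def using F shifts c \<beta>
    by (intro measurable_finite_tuple measurable_finite_pair measurable_compose[OF X.act_measurable]) auto
  have sub: "subgroup \<Lambda> G" unfolding ker using q.subgroup_kernel by (simp add: kernel_def)
  have ret: "returns \<subseteq> carrier (G\<lparr>carrier := \<Lambda>\<rparr>)" using returns(2) by (simp add: ker)
  define \<delta> where "\<delta> = \<epsilon> / (2 * (real (card F) + 1))"
  have \<delta>: "0 < \<delta>" using \<epsilon> by (simp add: \<delta>_def)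
  obtain w' where w'm: "w' \<in> measurable X (count_space W)"
    and close: "\<And>P. \<bar>measure Z {z \<in> space Z. P (\<lambda>l\<in>returns. w (b (inv\<^bsub>G\<lparr>carrier := \<Lambda>\<rparr>\<^esub> l) z)) (v (f z))}
      - measure X {x \<in> space X. P (\<lambda>l\<in>returns. w' (a (inv\<^bsub>G\<lparr>carrier := \<Lambda>\<rparr>\<^esub> l) x)) (v x)}\<bar> \<le> \<delta>"
    using ec_factor_map_finite_labels[OF ec W wm V vm returns(1) ret \<delta>] by blast
  have inv_eq: "(\<lambda>l\<in>returns. w (b (inv\<^bsub>G\<lparr>carrier := \<Lambda>\<rparr>\<^esub> l) z)) = (\<lambda>l\<in>returns. w (b (inv\<^bsub>G\<^esub> l) z))"
    "(\<lambda>l\<in>returns. w' (a (inv\<^bsub>G\<lparr>carrier := \<Lambda>\<rparr>\<^esub> l) x)) = (\<lambda>l\<in>returns. w' (a (inv\<^bsub>G\<^esub> l) x))" for z x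
    using q.G.m_inv_consistent[OF sub] ret by (intro restrict_ext; auto)+
  define \<alpha>' where "\<alpha>' x = w' (a (inv\<^bsub>G\<^esub> (r (c x))) x) (c x)" for x
  have w'F: "w' x h < p" if "x \<in> space X" "h \<in> F" for x h
    using measurable_space[OF w'm that(1)] that(2) by (auto simp: W_def)
  have \<alpha>'m: "\<alpha>' \<in> measurable X (count_space {..<p})"
  proof (rule measurable_count_space_eq2[THEN iffD2], simp, intro conjI ballI)
    have "\<alpha>' x < p" if "x \<in> space X" for x
      unfolding \<alpha>'_def using that cF r by (intro w'F X.act_closed) auto
    then show "\<alpha>' \<in> space X \<rightarrow> {..<p}" by auto
    fix i
    have "\<alpha>' -` {i} \<inter> space X
        = (\<Union>h\<in>F. {x \<in> space X. c x = h} \<inter> {x \<in> space X. w' (a (inv\<^bsub>G\<^esub> (r h)) x) h = i})"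
      using cF by (auto simp: \<alpha>'_def)
    also have "\<dots> \<in> sets X"
    proof (intro sets.finite_UN sets.Int F)
      fix h assume "h \<in> F"
      then have "inv\<^bsub>G\<^esub> (r h) \<in> carrier G" using r by simp
      then show "{x \<in> space X. w' (a (inv\<^bsub>G\<^esub> (r h)) x) h = i} \<in> sets X"
        using finite_valued_pred[OF measurable_compose[OF X.act_measurable w'm] W, of _ "\<lambda>u. u h = i"] by simp
    qed (rule finite_valued_pred[OF c F(1)])
    finally show "\<alpha>' -` {i} \<inter> space X \<in> sets X" .
  qed
  show "\<exists>\<alpha>' \<in> measurable X (count_space {..<p}). \<forall>\<pi> \<in> S \<rightarrow>\<^sub>E {..<p}. \<forall>j<m.
      \<bar>measure Z (translates G b S \<alpha> -` {\<pi>} \<inter> f -` (\<beta> -` {j}) \<inter> space Z)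
       - measure X (translates G a S \<alpha>' -` {\<pi>} \<inter> \<beta> -` {j} \<inter> space X)\<bar> < \<epsilon>"
  proof (intro bexI[OF _ \<alpha>'m] ballI allI impI)
    fix \<pi> j assume \<pi>: "\<pi> \<in> S \<rightarrow>\<^sub>E {..<p}" and "j < m"
    let ?PZ = "\<lambda>h. measure Z {z \<in> space Z. pattern \<pi> j h (\<lambda>l\<in>returns. w (b (inv\<^bsub>G\<^esub> l) z)) (v (f z))}"
    let ?PX = "\<lambda>h. measure X {x \<in> space X. pattern \<pi> j h (\<lambda>l\<in>returns. w' (a (inv\<^bsub>G\<^esub> l) x)) (v x)}"
    have tr: "translates G d S \<gamma> y = \<pi> \<longleftrightarrow> (\<forall>s\<in>S. \<gamma> (d (inv\<^bsub>G\<^esub> s) y) = \<pi> s)" for d y and \<gamma> :: "'c \<Rightarrow> nat"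
      using \<pi> by (auto simp: translates_def PiE_def extensional_def restrict_def fun_eq_iff)
    have "\<bar>measure Z {z \<in> space Z. (\<forall>s\<in>S. \<alpha> (b (inv\<^bsub>G\<^esub> s) z) = \<pi> s) \<and> \<beta> (f z) = j} - (\<Sum>h\<in>F. ?PZ h)\<bar>
        \<le> card S * e"
      unfolding v_def
    proof (rule statistics_at_base[OF fm c \<beta> \<alpha> W wm])
      fix z assume z: "z \<in> space Z"
      have h: "c (f z) \<in> F" using cF measurable_space[OF f z] by simp
      then show "\<alpha> z = w (b (inv\<^bsub>G\<^esub> (r (c (f z)))) z) (c (f z))"
        using r z by (simp add: w_def Z.act_mult Z.act_one)
    qed (use ce in auto)
    moreover have "\<bar>measure X {x \<in> space X. (\<forall>s\<in>S. \<alpha>' (a (inv\<^bsub>G\<^esub> s) x) = \<pi> s) \<and> \<beta> x = j} - (\<Sum>h\<in>F. ?PX h)\<bar>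
        \<le> card S * e"
      unfolding v_def
      by (rule statistics_at_base[OF factor_map_refl[OF X.pmp] c \<beta> \<alpha>'m W w'm])
        (use ce in \<open>auto simp: \<alpha>'_def\<close>)
    moreover have "\<bar>(\<Sum>h\<in>F. ?PZ h) - (\<Sum>h\<in>F. ?PX h)\<bar> \<le> card F * \<delta>"
    proof -
      have "\<bar>(\<Sum>h\<in>F. ?PZ h) - (\<Sum>h\<in>F. ?PX h)\<bar> \<le> (\<Sum>h\<in>F. \<bar>?PZ h - ?PX h\<bar>)"
        unfolding sum_subtractf[symmetric] by (rule sum_abs)
      \<comment> \<open>\<open>close\<close> holds for all predicates with the same
        \<open>w'\<close>, hence one \<open>\<alpha>'\<close> works for every \<open>\<pi>\<close>
        and \<open>j\<close>.\<close>
      also have "\<dots> \<le> (\<Sum>h\<in>F. \<delta>)"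
        using close[of "pattern \<pi> j _"] unfolding inv_eq by (intro sum_mono)
      finally show ?thesis by simp
    qed
    moreover have "card S * e < \<epsilon> / 4"
      using \<epsilon> by (simp add: e_def field_simps)
    moreover have "card F * \<delta> < \<epsilon> / 2"
      using \<epsilon> by (simp add: \<delta>_def field_simps)
    moreover have "translates G b S \<alpha> -` {\<pi>} \<inter> f -` (\<beta> -` {j}) \<inter> space Z
        = {z \<in> space Z. (\<forall>s\<in>S. \<alpha> (b (inv\<^bsub>G\<^esub> s) z) = \<pi> s) \<and> \<beta> (f z) = j}"
      "translates G a S \<alpha>' -` {\<pi>} \<inter> \<beta> -` {j} \<inter> space X
        = {x \<in> space X. (\<forall>s\<in>S. \<alpha>' (a (inv\<^bsub>G\<^esub> s) x) = \<pi> s) \<and> \<beta> x = j}"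
      by (simp_all add: set_eq_iff tr conj_ac)
    ultimately show "\<bar>measure Z (translates G b S \<alpha> -` {\<pi>} \<inter> f -` (\<beta> -` {j}) \<inter> space Z)
       - measure X (translates G a S \<alpha>' -` {\<pi>} \<inter> \<beta> -` {j} \<inter> space X)\<bar> < \<epsilon>"
      by (simp only:)
  qed
qed

lemma pmp_action_subgroup:
  assumes "pmp_action G M a" "subgroup H G"
  shows "pmp_action (G\<lparr>carrier := H\<rparr>) M a"
proof -
  have H: "H \<subseteq> carrier G" using assms(2) by (rule subgroup.subset)
  have "group_hom G (BijGroup (space M)) a"
    using assms(1) by (simp add: pmp_action_def group_action_def)
  then have "group_action (G\<lparr>carrier := H\<rparr>) (space M) a"
    using assms(2) H
    by (auto simp: group_action_def group_hom_def group_hom_axioms_def hom_def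
        intro: subgroup.subgroup_is_group)
  then show ?thesis using assms(1) H by (auto simp: pmp_action_def)
qed

theorem theorem5p18:
  fixes \<Gamma> :: "('g, 'm) monoid_scheme" and \<Lambda> :: "'g set"
    and X :: "'x measure" and a :: "'g \<Rightarrow> 'x \<Rightarrow> 'x"
    and Y :: "'y measure" and b :: "'g \<Rightarrow> 'y \<Rightarrow> 'y"
  assumes "group \<Gamma>" and "countable (carrier \<Gamma>)"
    and "\<Lambda> \<lhd> \<Gamma>" and "amenable (\<Gamma> Mod \<Lambda>)"
    and "pmp_action \<Gamma> X a"
    and "pmp_action \<Gamma> Y b"
    and "\<And>y. y \<in> space Y \<Longrightarrow> stabilizer \<Gamma> b y = \<Lambda>"
    and "weakly_contains \<Gamma> X a Y b"
    and "ec_action (\<Gamma>\<lparr>carrier := \<Lambda>\<rparr>) X a"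
  shows "ec_action \<Gamma> X a"
proof -
  interpret N: normal \<Lambda> \<Gamma> by fact
  define q where "q g = \<Lambda> #>\<^bsub>\<Gamma>\<^esub> g" for g
  have hom: "group_hom \<Gamma> (\<Gamma> Mod \<Lambda>) q"
    using N.r_coset_hom_Mod N.factorgroup_is_group N.is_group
    by (simp add: group_hom_def group_hom_axioms_def q_def[abs_def])
  have surj: "q ` carrier \<Gamma> = carrier (\<Gamma> Mod \<Lambda>)"
    by (auto simp: q_def FactGroup_def RCOSETS_def)
  have ker: "\<Lambda> = {g \<in> carrier \<Gamma>. q g = \<one>\<^bsub>\<Gamma> Mod \<Lambda>\<^esub>}"
    using N.rcos_const N.coset_join1[OF _ _ N.subgroup_axioms] N.subset
    by (auto simp: q_def FactGroup_def)
  interpret Y: pmp_quotient \<Gamma> Y b "\<Gamma> Mod \<Lambda>" q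
  proof -
    interpret group_hom \<Gamma> "\<Gamma> Mod \<Lambda>" q by (rule hom)
    show "pmp_quotient \<Gamma> Y b (\<Gamma> Mod \<Lambda>) q"
    proof (unfold_locales)
      show "b g y = y \<longleftrightarrow> q g = \<one>\<^bsub>\<Gamma> Mod \<Lambda>\<^esub>" if "g \<in> carrier \<Gamma>" "y \<in> space Y" for g y
      proof -
        have "b g y = y \<longleftrightarrow> g \<in> \<Lambda>" using assms(7)[OF that(2)] that(1) by (auto simp: stabilizer_def)
        then show ?thesis using ker that(1) by blast
      qed
    qed (use assms surj in auto)
  qed
  \<comment> \<open>The stabilizer condition makes the quotient act freely on \<open>Y\<close>, so
    the tilings are built there; half of \<epsilon> is spent on them and half on the transfer to
    \<open>X\<close>.\<close>
  have maps: "\<exists>F c. finite F \<and> F \<subseteq> carrier (\<Gamma> Mod \<Lambda>) \<and> c \<in> measurable X (count_space F) \<and>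
        (\<forall>k\<in>K. measure X {x \<in> space X. c (a k x) \<noteq> q k \<otimes>\<^bsub>\<Gamma> Mod \<Lambda>\<^esub> c x} \<le> \<epsilon>)"
    if K: "finite K" "K \<subseteq> carrier \<Gamma>" and \<epsilon>: "0 < \<epsilon>" for K and \<epsilon> :: real
  proof -
    have \<epsilon>2: "0 < \<epsilon> / 2" using \<epsilon> by simp
    obtain F c where F: "finite F" "F \<subseteq> carrier (\<Gamma> Mod \<Lambda>)" "c \<in> measurable Y (count_space F)"
      and c: "\<And>k. k \<in> K \<Longrightarrow> measure Y {y \<in> space Y. c (b k y) \<noteq> q k \<otimes>\<^bsub>\<Gamma> Mod \<Lambda>\<^esub> c y} \<le> \<epsilon> / 2"
      by (rule Y.almost_equivariant_map[OF assms(4) K \<epsilon>2]) blast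
    obtain c' where c': "c' \<in> measurable X (count_space F)"
      "\<And>k. k \<in> K \<Longrightarrow> measure X {x \<in> space X. c' (a k x) \<noteq> q k \<otimes>\<^bsub>\<Gamma> Mod \<Lambda>\<^esub> c' x}
        \<le> measure Y {y \<in> space Y. c (b k y) \<noteq> q k \<otimes>\<^bsub>\<Gamma> Mod \<Lambda>\<^esub> c y} + \<epsilon> / 2"
      by (rule weak_containment_transfer[OF assms(5,6,8) F(1,3) K \<epsilon>2,
          where \<sigma> = "\<lambda>k u. q k \<otimes>\<^bsub>\<Gamma> Mod \<Lambda>\<^esub> u"]) blast
    have "measure X {x \<in> space X. c' (a k x) \<noteq> q k \<otimes>\<^bsub>\<Gamma> Mod \<Lambda>\<^esub> c' x} \<le> \<epsilon>" if "k \<in> K" for k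
      using c[OF that] c'(2)[OF that] by linarith
    then show ?thesis using F c'(1) by blast
  qed
  show ?thesis
    unfolding ec_action_def
  proof (intro conjI allI impI)
    fix Z :: "real measure" and d f
    assume fm: "factor_map \<Gamma> Z d X a f"
    then have "factor_map (\<Gamma>\<lparr>carrier := \<Lambda>\<rparr>) Z d X a f"
      using pmp_action_subgroup[OF _ N.subgroup_axioms, of Z d]
        pmp_action_subgroup[OF _ N.subgroup_axioms, of X a] N.subset
      by (auto simp: factor_map_def)
    then have "ec_factor_map (\<Gamma>\<lparr>carrier := \<Lambda>\<rparr>) Z d X a f"
      using assms(9) by (simp add: ec_action_def)
    then show "ec_factor_map \<Gamma> Z d X a f"
      by (rule ec_factor_map_extend[OF hom surj ker fm _ maps])
  qed fact
qed

end
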